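(* The full upper unitriangular group $\widetilde U=U_N(q)$ acts monomially from the right on $\mathbb C\hat V$ with respect to the basis $\hat V$, where for $u\in\widetilde U$ and $A\in V$ $$\chi_A u = z\,\chi_A.u = z\,\chi_{\pi(Au^{-t})},\qquad z=\theta\big(\kappa(A,\pi(u^{-1}))\big)=\chi_A(f(u^{-1}))\in\mathbb C^*.$$ Moreover the restriction of $f$ to $U$ is bijective. With respect to the restriction to $U$ of this monomial action, the map $f^*:\mathbb C\hat V\to\mathbb C U$ given by $$f^*(\chi_A)=\sum_{u\in U}\theta(\kappa(A,u))\,u\in\mathbb C U\qquad(A\in V)$$ is an isomorphism of right $\mathbb C U$-modules from $\mathbb C\hat V$ onto the right regular module $\mathbb C U_{\mathbb C U}$. In particular $\{\sum_{u\in U}\theta(\kappa(A,u))\,u \mid A\in V\}\subseteq\mathbb C U$ is a monomial basis of the group algebra $\mathbb C U$ (a $\mathbb C$-basis whose elements are permuted up to nonzero scalars by right multiplication by elements of $U$).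
   Context: Let $p$ be an odd prime, $q$ a power of $p$, $n$ a natural number. Fix one of the types $\mathfrak B_n,\mathfrak C_n,\mathfrak D_n$; set $N=2n+1$ for $\mathfrak B_n$ and $N=2n$ for $\mathfrak C_n,\mathfrak D_n$. Put $\bar i=N+1-i$. Let $e_{ij}$ be the matrix units in $\mathrm{Mat}_{N\times N}(\mathbb F_q)$. Let $S=\sum_{i=1}^n e_{i\bar i}+\sum_{i=n+1}^N\epsilon e_{i\bar i}$, where $\epsilon=-1$ for type $\mathfrak C_n$ and $\epsilon=1$ otherwise, and $G=\{g\in GL_N(q)\mid g^tSg=S\}$. Let $\widetilde U=U_N(q)$ be the group of upper unitriangular $N\times N$ matrices over $\mathbb F_q$ and $U=G\cap\widetilde U$. Let $\mathcal P=\{(i,j)\mid 1\le i<j<\bar i\}$ for types $\mathfrak B_n,\mathfrak D_n$ and $\mathcal P=\{(i,j)\mid 1\le i<j\le\bar i\}$ for type $\mathfrak C_n$. Let $V=\bigoplus_{(i,j)\in\mathcal P}\mathbb F_q e_{ij}$, and let $\pi:\mathrm{Mat}_{N\times N}(\mathbb F_q)\to V$ be the projection setting all entries outside $\mathcal P$ to zero. Let $f:\widetilde U\to V$ be the restriction of $\pi$ to $\widetilde U$. Put $\kappa(A,B)=\mathrm{tr}(A^tB)$ for $A,B\in \mathrm{Mat}_{N\times N}(\mathbb F_q)$. Fix a nontrivial linear character $\theta:(\mathbb F_q,+)\to\mathbb C^*$; for $A\in V$ let $\chi_A:V\to\mathbb C^*$, $\chi_A(B)=\theta(\kappa(A,B))$.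 Then $\hat V=\{\chi_A\mid A\in V\}$ is the set of linear characters of $(V,+)$, a $\mathbb C$-basis of $\mathbb C\hat V=\mathbb C^V$ (all maps $V\to\mathbb C$). The group $\widetilde U$ acts on $V$ by $A.u=\pi(Au)$ and on $\hat V$ by $(\chi.u)(A)=\chi(A.u^{-1})$. We write $u^{-t}=(u^{-1})^t$. The map $f^*$ is $\tau\mapsto\sum_{u\in U}\tau(f(u))u$, i.e. the $\mathbb C$-linear extension of $(f|_U)^{-1}$ when $\tau\in\mathbb C^V$ is identified with $\sum_{v\in V}\tau(v)v\in\mathbb C V$. *)

theory Defs
  imports
    Complex_Main
    "HOL-Library.Function_Algebras"
    "HOL-Library.Cardinality"
    "HOL-Computational_Algebra.Primes"
    "HOL-Algebra.Ring"
    "Jordan_Normal_Form.Matrix"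
begin

text \<open>
  For a finite set \<open>X\<close>, the spaces \<open>\<complex>X\<close> and \<open>\<complex>\<^sup>X\<close> are both encoded as the set of
  functions \<open>'x \<Rightarrow> complex\<close> on the ambient type that vanish outside \<open>X\<close>.
  Matrix indices start at 0, following \<open>Jordan_Normal_Form\<close>; with this shift the involution
  \<open>i \<mapsto> N + 1 - i\<close> of \<open>{1..N}\<close> becomes \<open>i \<mapsto> N - 1 - i\<close> on \<open>{0..<N}\<close>.
\<close>

definition fscale :: "complex \<Rightarrow> ('x \<Rightarrow> complex) \<Rightarrow> ('x \<Rightarrow> complex)" where
  "fscale c f = (\<lambda>x. c * f x)"

global_interpretation fn: vector_space "fscale :: complex \<Rightarrow> ('x \<Rightarrow> complex) \<Rightarrow> _"
  by unfold_locales (auto simp: fscale_def fun_eq_iff algebra_simps)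

definition fun_space :: "'x set \<Rightarrow> ('x \<Rightarrow> complex) set" where
  "fun_space X = {\<tau>. \<forall>x. x \<notin> X \<longrightarrow> \<tau> x = 0}"

definition delta :: "'x \<Rightarrow> ('x \<Rightarrow> complex)" where
  "delta x = (\<lambda>y. if y = x then 1 else 0)"

definition is_basis :: "('x \<Rightarrow> complex) set \<Rightarrow> ('x \<Rightarrow> complex) set \<Rightarrow> bool" where
  "is_basis W B \<longleftrightarrow> fn.independent B \<and> fn.span B = W"

text \<open>The group algebra \<open>\<complex>H\<close>, meaningful for finite \<open>H\<close>.\<close>

definition group_algebra :: "('g, 'm) monoid_scheme \<Rightarrow> ('g \<Rightarrow> complex) ring" where
  "group_algebra H =
    \<lparr>carrier = fun_space (carrier H),
     monoid.mult = (\<lambda>a b. \<Sum>x\<in>carrier H. \<Sum>y\<in>carrier H. fscale (a x * b y) (delta (x \<otimes>\<^bsub>H\<^esub> y))),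
     one = delta \<one>\<^bsub>H\<^esub>,
     ring.zero = 0,
     ring.add = (+)\<rparr>"

locale linear_right_action = group H for H (structure) +
  fixes W :: "('x \<Rightarrow> complex) set" and act :: "('x \<Rightarrow> complex) \<Rightarrow> 'g \<Rightarrow> ('x \<Rightarrow> complex)"
  assumes subspace: "fn.subspace W"
    and act_closed: "\<lbrakk>v \<in> W; g \<in> carrier H\<rbrakk> \<Longrightarrow> act v g \<in> W"
    and act_add: "\<lbrakk>v \<in> W; w \<in> W; g \<in> carrier H\<rbrakk> \<Longrightarrow> act (v + w) g = act v g + act w g"
    and act_scale: "\<lbrakk>v \<in> W; g \<in> carrier H\<rbrakk> \<Longrightarrow> act (fscale c v) g = fscale c (act v g)"
    and act_one: "v \<in> W \<Longrightarrow> act v \<one> = v"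
    and act_mult: "\<lbrakk>v \<in> W; g \<in> carrier H; h \<in> carrier H\<rbrakk> \<Longrightarrow> act v (g \<otimes> h) = act (act v g) h"

locale monomial_action = linear_right_action +
  fixes B
  assumes basis: "is_basis W B"
    and monomial: "g \<in> carrier H \<Longrightarrow>
      \<exists>\<sigma> z. bij_betw \<sigma> B B \<and> (\<forall>b\<in>B. z b \<noteq> 0 \<and> act b g = fscale (z b) (\<sigma> b))"

locale right_module = ring R for R (structure) +
  fixes M :: "'m::ab_group_add set" and act :: "'m \<Rightarrow> 'r \<Rightarrow> 'm"
  assumes zero_mem: "0 \<in> M"
    and add_mem: "\<lbrakk>v \<in> M; w \<in> M\<rbrakk> \<Longrightarrow> v + w \<in> M"
    and uminus_mem: "v \<in> M \<Longrightarrow> - v \<in> M"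
    and act_mem: "\<lbrakk>v \<in> M; r \<in> carrier R\<rbrakk> \<Longrightarrow> act v r \<in> M"
    and act_add_left: "\<lbrakk>v \<in> M; w \<in> M; r \<in> carrier R\<rbrakk> \<Longrightarrow> act (v + w) r = act v r + act w r"
    and act_add_right: "\<lbrakk>v \<in> M; r \<in> carrier R; s \<in> carrier R\<rbrakk> \<Longrightarrow> act v (r \<oplus> s) = act v r + act v s"
    and act_mult: "\<lbrakk>v \<in> M; r \<in> carrier R; s \<in> carrier R\<rbrakk> \<Longrightarrow> act v (r \<otimes> s) = act (act v r) s"
    and act_one: "v \<in> M \<Longrightarrow> act v \<one> = v"

definition right_module_iso ::
    "('r, 'k) ring_scheme \<Rightarrow> 'm::ab_group_add set \<Rightarrow> ('m \<Rightarrow> 'r \<Rightarrow> 'm) \<Rightarrow>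
     'l::ab_group_add set \<Rightarrow> ('l \<Rightarrow> 'r \<Rightarrow> 'l) \<Rightarrow> ('m \<Rightarrow> 'l) \<Rightarrow> bool" where
  "right_module_iso R M act L act' h \<longleftrightarrow>
     right_module R M act \<and> right_module R L act' \<and> bij_betw h M L \<and>
     (\<forall>v\<in>M. \<forall>w\<in>M. h (v + w) = h v + h w) \<and>
     (\<forall>v\<in>M. \<forall>r\<in>carrier R. h (act v r) = act' (h v) r)"

definition algebra_act ::
    "('g, 'k) monoid_scheme \<Rightarrow> (('x \<Rightarrow> complex) \<Rightarrow> 'g \<Rightarrow> ('x \<Rightarrow> complex)) \<Rightarrow>
     ('x \<Rightarrow> complex) \<Rightarrow> ('g \<Rightarrow> complex) \<Rightarrow> ('x \<Rightarrow> complex)" where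
  "algebra_act H act \<tau> a = (\<Sum>h\<in>carrier H. fscale (a h) (act \<tau> h))"

datatype lie_type = TypeB | TypeC | TypeD

fun dimN :: "lie_type \<Rightarrow> nat \<Rightarrow> nat" where
  "dimN TypeB n = 2 * n + 1"
| "dimN TypeC n = 2 * n"
| "dimN TypeD n = 2 * n"

definition eps :: "lie_type \<Rightarrow> 'a::comm_ring_1" where
  "eps t = (if t = TypeC then - 1 else 1)"

definition formS :: "lie_type \<Rightarrow> nat \<Rightarrow> 'a::comm_ring_1 mat" where
  "formS t n = mat (dimN t n) (dimN t n)
     (\<lambda>(i, j). if j = dimN t n - 1 - i then (if i < n then 1 else eps t) else 0)"

definition GL :: "nat \<Rightarrow> 'a::field mat monoid" where
  "GL N = units_of (ring_mat TYPE('a) N ())"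

definition classical_group :: "lie_type \<Rightarrow> nat \<Rightarrow> 'a::field mat set" where
  "classical_group t n =
     {g \<in> carrier (GL (dimN t n)). transpose_mat g * formS t n * g = formS t n}"

definition Utilde :: "lie_type \<Rightarrow> nat \<Rightarrow> 'a::field mat set" where
  "Utilde t n = {u \<in> carrier_mat (dimN t n) (dimN t n).
     upper_triangular u \<and> (\<forall>i < dimN t n. u $$ (i, i) = 1)}"

definition U :: "lie_type \<Rightarrow> nat \<Rightarrow> 'a::field mat set" where
  "U t n = classical_group t n \<inter> Utilde t n"

definition Utilde_group :: "lie_type \<Rightarrow> nat \<Rightarrow> 'a::field mat monoid" where
  "Utilde_group t n = (GL (dimN t n))\<lparr>carrier := Utilde t n\<rparr>"

definition U_group :: "lie_type \<Rightarrow> nat \<Rightarrow> 'a::field mat monoid" where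
  "U_group t n = (GL (dimN t n))\<lparr>carrier := U t n\<rparr>"

definition minv :: "'a::field mat \<Rightarrow> 'a mat" where
  "minv u = inv\<^bsub>GL (dim_row u)\<^esub> u"

definition posP :: "lie_type \<Rightarrow> nat \<Rightarrow> (nat \<times> nat) set" where
  "posP t n = {(i, j). i < j \<and>
     (if t = TypeC then j \<le> dimN t n - 1 - i else j < dimN t n - 1 - i)}"

definition V :: "lie_type \<Rightarrow> nat \<Rightarrow> 'a::field mat set" where
  "V t n = {A \<in> carrier_mat (dimN t n) (dimN t n).
     \<forall>i < dimN t n. \<forall>j < dimN t n. (i, j) \<notin> posP t n \<longrightarrow> A $$ (i, j) = 0}"

definition proj :: "lie_type \<Rightarrow> nat \<Rightarrow> 'a::field mat \<Rightarrow> 'a mat" where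
  "proj t n A = mat (dimN t n) (dimN t n) (\<lambda>(i, j). if (i, j) \<in> posP t n then A $$ (i, j) else 0)"

definition f :: "lie_type \<Rightarrow> nat \<Rightarrow> 'a::field mat \<Rightarrow> 'a mat" where
  "f t n = restrict (proj t n) (Utilde t n)"

definition V_act :: "lie_type \<Rightarrow> nat \<Rightarrow> 'a::field mat \<Rightarrow> 'a mat \<Rightarrow> 'a mat" where
  "V_act t n A u = proj t n (A * u)"

definition kappa :: "'a::field mat \<Rightarrow> 'a mat \<Rightarrow> 'a" where
  "kappa A B = sum_list (diag_mat (transpose_mat A * B))"

definition nontrivial_linear_character :: "('a::field \<Rightarrow> complex) \<Rightarrow> bool" where
  "nontrivial_linear_character \<theta> \<longleftrightarrow>
     (\<forall>x. \<theta> x \<noteq> 0) \<and> (\<forall>x y. \<theta> (x + y) = \<theta> x * \<theta> y) \<and> (\<exists>x. \<theta> x \<noteq> 1)"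

definition chi :: "lie_type \<Rightarrow> nat \<Rightarrow> ('a::field \<Rightarrow> complex) \<Rightarrow> 'a mat \<Rightarrow> ('a mat \<Rightarrow> complex)" where
  "chi t n \<theta> A = (\<lambda>B. if B \<in> V t n then \<theta> (kappa A B) else 0)"

definition Vhat :: "lie_type \<Rightarrow> nat \<Rightarrow> ('a::field \<Rightarrow> complex) \<Rightarrow> ('a mat \<Rightarrow> complex) set" where
  "Vhat t n \<theta> = chi t n \<theta> ` V t n"

definition Vhat_act ::
    "lie_type \<Rightarrow> nat \<Rightarrow> ('a::field mat \<Rightarrow> complex) \<Rightarrow> 'a mat \<Rightarrow> ('a mat \<Rightarrow> complex)" where
  "Vhat_act t n \<chi> u = (\<lambda>A. if A \<in> V t n then \<chi> (V_act t n A (minv u)) else 0)"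

text \<open>
  The \<open>\<complex>\<close>-linear extension to \<open>\<complex>V\<hat>\<close> of \<open>\<chi> u = \<chi>(f(u\<inverse>)) \<chi>.u\<close> for basis elements \<open>\<chi>\<close>:
  the coefficients of \<open>\<tau>\<close> are those of its expansion in the basis \<open>Vhat\<close>.
\<close>

definition mon_act ::
    "lie_type \<Rightarrow> nat \<Rightarrow> ('a::field \<Rightarrow> complex) \<Rightarrow> ('a mat \<Rightarrow> complex) \<Rightarrow> 'a mat \<Rightarrow> ('a mat \<Rightarrow> complex)" where
  "mon_act t n \<theta> \<tau> u = (\<Sum>\<chi>\<in>Vhat t n \<theta>.
     fscale (fn.representation (Vhat t n \<theta>) \<tau> \<chi>)
       (fscale (\<chi> (f t n (minv u))) (Vhat_act t n \<chi> u)))"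

definition fstar :: "lie_type \<Rightarrow> nat \<Rightarrow> ('a::field mat \<Rightarrow> complex) \<Rightarrow> ('a mat \<Rightarrow> complex)" where
  "fstar t n \<tau> = (\<Sum>u\<in>U t n. fscale (\<tau> (f t n u)) (delta u))"

definition U_elem :: "lie_type \<Rightarrow> nat \<Rightarrow> ('a::field \<Rightarrow> complex) \<Rightarrow> 'a mat \<Rightarrow> ('a mat \<Rightarrow> complex)" where
  "U_elem t n \<theta> A = (\<Sum>u\<in>U t n. fscale (\<theta> (kappa A u)) (delta u))"

end

theory Submission
  imports Defs "Jordan_Normal_Form.Determinant"
begin

text \<open>
  Set \<open>A \<star> u = \<pi>((1 + A) u)\<close> for \<open>A \<in> V\<close>. As \<open>\<pi>(x u)\<close> depends on \<open>x\<close> only through \<open>\<pi>(x)\<close>, this is a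
  right action of the unitriangular group on \<open>V\<close> by affine maps, \<open>A \<star> u = A.u + f(u)\<close>, and
  \<open>f(x) \<star> u = f(x u)\<close>. Evaluating characters on \<open>B \<star> u\<inverse>\<close> gives the monomial action on them, so
  its linear extension is \<open>(\<tau> u)(B) = \<tau>(B \<star> u\<inverse>)\<close>. Hence once \<open>f\<close> is a bijection from \<open>U\<close> onto \<open>V\<close>, pulling
  back along \<open>f\<close> is an isomorphism with the regular module.

  Injectivity of \<open>f\<close> on \<open>U\<close> reduces, by the action, to: \<open>g \<in> U\<close> and \<open>\<pi>(g) = 0\<close> imply \<open>g = 1\<close>, which is read
  off row by row from \<open>g\<^sup>t S g = S\<close>. For surjectivity it suffices that \<open>U\<close> has at least as many elements as
  \<open>V\<close>: the Cayley transform \<open>X \<mapsto> (1 + X) (1 - X)\<inverse>\<close> embeds the nilpotent Lie algebra of \<open>U\<close>, whose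
  elements are determined by their entries in \<open>\<P>\<close>, into \<open>U\<close>. Both steps divide by 2.
\<close>

section \<open>Group algebras and linear actions\<close>

lemma fun_sum_apply: "(\<Sum>x\<in>A. g x) y = (\<Sum>x\<in>A. g x y)"
  by (induction A rule: infinite_finite_induct) auto

lemma subspace_fun_space: "fn.subspace (fun_space X)"
  by (auto simp: fn.subspace_def fun_space_def fscale_def)

lemma fun_space_uminus: "v \<in> fun_space X \<Longrightarrow> - v \<in> fun_space X"
  by (auto simp: fun_space_def)

lemma group_algebra_simps:
  "carrier (group_algebra H) = fun_space (carrier H)"
  "\<one>\<^bsub>group_algebra H\<^esub> = delta \<one>\<^bsub>H\<^esub>"
  "\<zero>\<^bsub>group_algebra H\<^esub> = 0"
  "a \<oplus>\<^bsub>group_algebra H\<^esub> b = a + b"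
  by (auto simp: group_algebra_def)

lemma group_algebra_mult_apply:
  "(a \<otimes>\<^bsub>group_algebra H\<^esub> b) z =
    (\<Sum>x\<in>carrier H. \<Sum>y\<in>carrier H. a x * b y * delta (x \<otimes>\<^bsub>H\<^esub> y) z)"
  by (simp add: group_algebra_def fun_sum_apply fscale_def)

lemma delta_in_fun_space: "x \<in> X \<Longrightarrow> delta x \<in> fun_space X"
  by (auto simp: delta_def fun_space_def)

lemma fun_space_delta_sum:
  assumes "\<tau> \<in> fun_space X" "finite X"
  shows "\<tau> = (\<Sum>x\<in>X. fscale (\<tau> x) (delta x))"
proof
  fix y
  have "(\<Sum>x\<in>X. fscale (\<tau> x) (delta x)) y = (\<Sum>x\<in>X. if x = y then \<tau> x else 0)"
    by (auto simp: fun_sum_apply fscale_def delta_def intro!: sum.cong)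
  then show "\<tau> y = (\<Sum>x\<in>X. fscale (\<tau> x) (delta x)) y"
    using assms by (auto simp: fun_space_def)
qed

section \<open>Convolution and the regular module of a finite group\<close>

context group
begin

lemma group_algebra_mult_closed: "a \<otimes>\<^bsub>group_algebra G\<^esub> b \<in> fun_space (carrier G)"
  unfolding fun_space_def by (auto simp: group_algebra_mult_apply delta_def intro!: sum.neutral)

text \<open>For fixed \<open>h\<close> the equation \<open>y h = x\<close> has the single solution
  \<open>y = x h^-1\<close>, so the inner sum collapses. With the inverse inside the argument of
  \<open>a\<close>, the product looks like an action by moving arguments, the shape in which it is
  later compared with \<open>mon_act\<close>.\<close>

lemma group_algebra_mult_convolution:
  assumes "finite (carrier G)" "x \<in> carrier G"
  shows "(a \<otimes>\<^bsub>group_algebra G\<^esub> b) x = (\<Sum>h\<in>carrier G. b h * a (x \<otimes> inv h))"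
proof -
  have "(\<Sum>y\<in>carrier G. a y * b h * delta (y \<otimes> h) x) = b h * a (x \<otimes> inv h)"
    if h: "h \<in> carrier G" for h
  proof -
    have "(\<Sum>y\<in>carrier G. a y * b h * delta (y \<otimes> h) x)
        = (\<Sum>y\<in>carrier G. if y = x \<otimes> inv h then a y * b h else 0)"
      using h assms by (intro sum.cong refl) (auto simp: delta_def inv_solve_right)
    then show ?thesis
      using h assms by simp
  qed
  then show ?thesis
    unfolding group_algebra_mult_apply by (subst sum.swap) (simp cong: sum.cong)
qed

text \<open>Pairing a product with an arbitrary weight \<open>F\<close> removes the deltas once and
  for all. Associativity and the module law for linear actions are both instances, with different
  choices of \<open>F\<close>.\<close>

lemma sum_group_algebra_mult:
  assumes "finite (carrier G)"
  shows "(\<Sum>z\<in>carrier G. (a \<otimes>\<^bsub>group_algebra G\<^esub> b) z * F z) =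
    (\<Sum>x\<in>carrier G. \<Sum>y\<in>carrier G. a x * b y * F (x \<otimes> y))"
proof -
  have "(\<Sum>z\<in>carrier G. a x * b y * delta (x \<otimes> y) z * F z) = a x * b y * F (x \<otimes> y)"
    if "x \<in> carrier G" "y \<in> carrier G" for x y
  proof -
    have "(\<Sum>z\<in>carrier G. a x * b y * delta (x \<otimes> y) z * F z)
        = (\<Sum>z\<in>carrier G. if z = x \<otimes> y then a x * b y * F z else 0)"
      by (intro sum.cong refl) (auto simp: delta_def)
    then show ?thesis
      using that assms by simp
  qed
  note * = this
  have "(\<Sum>z\<in>carrier G. (a \<otimes>\<^bsub>group_algebra G\<^esub> b) z * F z) =
     (\<Sum>z\<in>carrier G. \<Sum>x\<in>carrier G. \<Sum>y\<in>carrier G. a x * b y * delta (x \<otimes> y) z * F z)"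
    by (simp add: group_algebra_mult_apply sum_distrib_right)
  also have "\<dots> = (\<Sum>x\<in>carrier G. \<Sum>z\<in>carrier G. \<Sum>y\<in>carrier G. a x * b y * delta (x \<otimes> y) z * F z)"
    by (rule sum.swap)
  also have "\<dots> = (\<Sum>x\<in>carrier G. \<Sum>y\<in>carrier G. \<Sum>z\<in>carrier G. a x * b y * delta (x \<otimes> y) z * F z)"
    by (intro sum.cong refl sum.swap)
  also have "\<dots> = (\<Sum>x\<in>carrier G. \<Sum>y\<in>carrier G. a x * b y * F (x \<otimes> y))"
    by (intro sum.cong refl *)
  finally show ?thesis .
qed

text \<open>Each bracketing is read as a product paired with a weight that contains the remaining
  factor; both then become the same triple sum by associativity in the group.\<close>

lemma group_algebra_mult_assoc:
  assumes "finite (carrier G)"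
  shows "(a \<otimes>\<^bsub>group_algebra G\<^esub> b) \<otimes>\<^bsub>group_algebra G\<^esub> c =
    a \<otimes>\<^bsub>group_algebra G\<^esub> (b \<otimes>\<^bsub>group_algebra G\<^esub> c)"
proof
  fix z
  let ?m = "\<lambda>a b. a \<otimes>\<^bsub>group_algebra G\<^esub> b"
  have "?m (?m a b) c z = (\<Sum>x\<in>carrier G. ?m a b x * (\<Sum>w\<in>carrier G. c w * delta (x \<otimes> w) z))"
    by (simp add: group_algebra_mult_apply[of _ "?m a b"] sum_distrib_left mult.assoc)
  also have "\<dots> = (\<Sum>x\<in>carrier G. \<Sum>y\<in>carrier G. a x * b y *
      (\<Sum>w\<in>carrier G. c w * delta (x \<otimes> y \<otimes> w) z))"
    by (rule sum_group_algebra_mult[OF assms])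
  also have "\<dots> = (\<Sum>x\<in>carrier G. a x * (\<Sum>y\<in>carrier G. \<Sum>w\<in>carrier G.
      b y * c w * delta (x \<otimes> (y \<otimes> w)) z))"
    by (intro sum.cong refl) (simp add: sum_distrib_left m_assoc mult.assoc cong: sum.cong)
  also have "\<dots> = (\<Sum>x\<in>carrier G. a x * (\<Sum>v\<in>carrier G. ?m b c v * delta (x \<otimes> v) z))"
    by (simp add: sum_group_algebra_mult[OF assms])
  also have "\<dots> = ?m a (?m b c) z"
    by (simp add: group_algebra_mult_apply[of _ a "?m b c"] sum_distrib_left mult.assoc)
  finally show "?m (?m a b) c z = ?m a (?m b c) z" .
qed

lemma group_algebra_mult_delta:
  assumes "finite (carrier G)" "g \<in> carrier G" "x \<in> carrier G"
  shows "(a \<otimes>\<^bsub>group_algebra G\<^esub> delta g) x = a (x \<otimes> inv g)"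
proof -
  have "(a \<otimes>\<^bsub>group_algebra G\<^esub> delta g) x =
      (\<Sum>h\<in>carrier G. if h = g then a (x \<otimes> inv h) else 0)"
    unfolding group_algebra_mult_convolution[OF assms(1,3)]
    by (intro sum.cong refl) (auto simp: delta_def)
  with assms show ?thesis
    by simp
qed

lemma group_algebra_mult_one:
  assumes "finite (carrier G)" "a \<in> fun_space (carrier G)"
  shows "a \<otimes>\<^bsub>group_algebra G\<^esub> delta \<one> = a"
proof
  fix x
  show "(a \<otimes>\<^bsub>group_algebra G\<^esub> delta \<one>) x = a x"
    using assms group_algebra_mult_closed[of a "delta \<one>"]
    by (cases "x \<in> carrier G") (auto simp: group_algebra_mult_delta fun_space_def)
qed

lemma group_algebra_one_mult:
  assumes "finite (carrier G)" "a \<in> fun_space (carrier G)"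
  shows "delta \<one> \<otimes>\<^bsub>group_algebra G\<^esub> a = a"
proof
  fix x
  show "(delta \<one> \<otimes>\<^bsub>group_algebra G\<^esub> a) x = a x"
  proof (cases "x \<in> carrier G")
    case True
    then have "(delta \<one> \<otimes>\<^bsub>group_algebra G\<^esub> a) x = (\<Sum>h\<in>carrier G. if h = x then a h else 0)"
      unfolding group_algebra_mult_convolution[OF assms(1) True]
      using inv_equality[of x "inv x"] 
      by (intro sum.cong refl) (auto simp: delta_def inv_solve_right')
    with True assms show ?thesis
      by simp
  qed (use assms group_algebra_mult_closed[of "delta \<one>" a] in \<open>auto simp: fun_space_def\<close>)
qed

lemma ring_group_algebra:
  assumes "finite (carrier G)"
  shows "ring (group_algebra G)"
proof (rule ringI)
  show "abelian_group (group_algebra G)"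
  proof (rule abelian_groupI)
    fix a assume "a \<in> carrier (group_algebra G)"
    then show "\<exists>b\<in>carrier (group_algebra G). b \<oplus>\<^bsub>group_algebra G\<^esub> a = \<zero>\<^bsub>group_algebra G\<^esub>"
      by (intro bexI[of _ "- a"]) (auto simp: group_algebra_simps fun_space_uminus)
  qed (auto simp: group_algebra_simps fn.subspace_add subspace_fun_space fn.subspace_0 algebra_simps)
  show "Group.monoid (group_algebra G)"
    by unfold_locales
      (auto simp: group_algebra_simps group_algebra_mult_closed group_algebra_mult_assoc assms
        group_algebra_mult_one group_algebra_one_mult delta_in_fun_space)
qed (auto simp: group_algebra_simps group_algebra_mult_apply algebra_simps sum.distrib)

lemma right_module_group_algebra:
  assumes "finite (carrier G)"
  shows "right_module (group_algebra G) (carrier (group_algebra G))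
    (\<lambda>a b. a \<otimes>\<^bsub>group_algebra G\<^esub> b)"
proof -
  interpret R: ring "group_algebra G"
    by (rule ring_group_algebra[OF assms])
  show ?thesis
    by unfold_locales
      (use R.m_closed R.l_distr R.r_distr R.m_assoc R.r_one in
        \<open>auto simp: group_algebra_simps fun_space_uminus fn.subspace_add subspace_fun_space fn.subspace_0\<close>)
qed

end

section \<open>Modules over the group algebra from linear group actions\<close>

lemma (in linear_right_action) algebra_act_in:
  assumes "v \<in> W"
  shows "algebra_act H act v a \<in> W"
  unfolding algebra_act_def
  by (intro fn.subspace_sum[OF subspace] fn.subspace_scale[OF subspace] act_closed assms)

lemma (in linear_right_action) act_sum:
  assumes "g \<in> carrier H" "\<And>i. i \<in> I \<Longrightarrow> v i \<in> W"
  shows "act (\<Sum>i\<in>I. fscale (c i) (v i)) g = (\<Sum>i\<in>I. fscale (c i) (act (v i) g))"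
proof -
  \<comment> \<open>Homogeneity with scalar 0 gives this; it settles the empty index set and also
    the infinite one, over which the sum is 0 by convention.\<close>
  have "act 0 g = 0"
    using act_scale[of 0 g 0] assms(1) fn.subspace_0[OF subspace] by simp
  then show ?thesis
    using assms(2)
  proof (induction I rule: infinite_finite_induct)
    case (insert i I)
    then have "act (fscale (c i) (v i) + (\<Sum>i\<in>I. fscale (c i) (v i))) g =
        act (fscale (c i) (v i)) g + act (\<Sum>i\<in>I. fscale (c i) (v i)) g"
      using assms(1)
      by (intro act_add fn.subspace_sum[OF subspace] fn.subspace_scale[OF subspace]) auto
    with insert assms(1) show ?case
      by (simp only: sum.insert act_scale[of "v i" g "c i"] insertCI insert_iff simp_thms)
  qed (simp_all only: sum.infinite sum.empty simp_thms)
qed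

lemma (in linear_right_action) right_module_algebra_act:
  assumes fin: "finite (carrier H)"
  shows "right_module (group_algebra H) W (algebra_act H act)"
proof -
  interpret R: ring "group_algebra H"
    by (rule ring_group_algebra[OF assms])
  show ?thesis
  proof
    show "0 \<in> W"
      by (rule fn.subspace_0[OF subspace])
    show "v + w \<in> W" if "v \<in> W" "w \<in> W" for v w
      using that by (rule fn.subspace_add[OF subspace])
    show "- v \<in> W" if "v \<in> W" for v
      using that by (rule fn.subspace_neg[OF subspace])
    show "algebra_act H act v r \<in> W" if "v \<in> W" for v r
      by (rule algebra_act_in[OF that])
    show "algebra_act H act (v + w) r = algebra_act H act v r + algebra_act H act w r"
      if "v \<in> W" "w \<in> W" for v w r
      using that by (simp add: algebra_act_def act_add fn.scale_right_distrib sum.distrib)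
    show "algebra_act H act v (r \<oplus>\<^bsub>group_algebra H\<^esub> s) = algebra_act H act v r + algebra_act H act v s"
      for v r s
      by (simp add: algebra_act_def group_algebra_simps fn.scale_left_distrib sum.distrib)
    show "algebra_act H act v (r \<otimes>\<^bsub>group_algebra H\<^esub> s) = algebra_act H act (algebra_act H act v r) s"
      if v: "v \<in> W" for v r s
    proof
      fix x
      have act_r: "act (algebra_act H act v r) h x = (\<Sum>g\<in>carrier H. r g * act (act v g) h x)"
        if "h \<in> carrier H" for h
        using that v by (simp add: algebra_act_def act_sum act_closed fun_sum_apply)
          (simp add: fscale_def)
      have "algebra_act H act v (r \<otimes>\<^bsub>group_algebra H\<^esub> s) x =
          (\<Sum>z\<in>carrier H. (r \<otimes>\<^bsub>group_algebra H\<^esub> s) z * act v z x)"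
        by (simp add: algebra_act_def fun_sum_apply fscale_def)
      \<comment> \<open>The weight in the pairing is \<open>z\<close> sent to the value of
        \<open>act v z\<close> at the fixed point \<open>x\<close>.\<close>
      also have "\<dots> = (\<Sum>g\<in>carrier H. \<Sum>h\<in>carrier H. r g * s h * act v (g \<otimes> h) x)"
        by (rule sum_group_algebra_mult[OF fin])
      also have "\<dots> = (\<Sum>h\<in>carrier H. \<Sum>g\<in>carrier H. r g * s h * act (act v g) h x)"
        by (subst sum.swap) (simp add: act_mult v cong: sum.cong)
      also have "\<dots> = (\<Sum>h\<in>carrier H. s h * (\<Sum>g\<in>carrier H. r g * act (act v g) h x))"
        by (simp add: sum_distrib_left mult_ac)
      also have "\<dots> = algebra_act H act (algebra_act H act v r) s x"
        by (simp add: algebra_act_def[of _ _ "algebra_act H act v r"] act_r fun_sum_apply fscale_def)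
      finally show "algebra_act H act v (r \<otimes>\<^bsub>group_algebra H\<^esub> s) x =
        algebra_act H act (algebra_act H act v r) s x" .
    qed
    show "algebra_act H act v \<one>\<^bsub>group_algebra H\<^esub> = v" if "v \<in> W" for v
    proof -
      have "algebra_act H act v \<one>\<^bsub>group_algebra H\<^esub> = (\<Sum>h\<in>carrier H. if h = \<one> then act v h else 0)"
        unfolding algebra_act_def
        by (intro sum.cong refl) (auto simp: group_algebra_simps delta_def fscale_def fun_eq_iff)
      with that fin show ?thesis
        by (simp add: act_one)
    qed
  qed
qed

text \<open>\<open>delta\<close> turns the group product into the algebra product, so the action
  laws are associativity and the unit law of the algebra.\<close>

lemma linear_right_action_group_algebra:
  fixes H (structure)
  assumes "group H" "finite (carrier H)"
  shows "linear_right_action H (carrier (group_algebra H)) (\<lambda>a g. a \<otimes>\<^bsub>group_algebra H\<^esub> delta g)"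
proof -
  interpret group H by fact
  interpret R: ring "group_algebra H"
    by (rule ring_group_algebra[OF assms(2)])
  have delta_mult: "delta (g \<otimes> h) = delta g \<otimes>\<^bsub>group_algebra H\<^esub> delta h"
    if gh: "g \<in> carrier H" "h \<in> carrier H" for g h
  proof
    fix x
    show "delta (g \<otimes> h) x = (delta g \<otimes>\<^bsub>group_algebra H\<^esub> delta h) x"
    proof (cases "x \<in> carrier H")
      case True
      with gh assms(2) show ?thesis
        by (auto simp: group_algebra_mult_delta) (auto simp: delta_def inv_solve_right')
    next
      case False
      with gh group_algebra_mult_closed[of "delta g" "delta h"] show ?thesis
        by (auto simp: delta_def fun_space_def)
    qed
  qed
  show ?thesis
    by unfold_locales
      (auto simp: group_algebra_simps subspace_fun_space group_algebra_mult_closed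
        group_algebra_mult_one assms(2) delta_mult group_algebra_mult_assoc
        group_algebra_mult_apply fscale_def algebra_simps sum.distrib sum_distrib_left)
qed

section \<open>Restriction and transport of monomial actions\<close>

lemma (in monomial_action) restrict_subgroup:
  assumes "subgroup K H"
  shows "monomial_action (H\<lparr>carrier := K\<rparr>) W act B"
proof -
  interpret K: group "H\<lparr>carrier := K\<rparr>"
    by (rule subgroup_imp_group[OF assms])
  note [simp] = subgroup.mem_carrier[OF assms]
  show ?thesis
  proof unfold_locales
    fix g assume "g \<in> carrier (H\<lparr>carrier := K\<rparr>)"
    then have "g \<in> carrier H"
      by simp
    then show "\<exists>\<sigma> z. bij_betw \<sigma> B B \<and> (\<forall>b\<in>B. z b \<noteq> 0 \<and> act b g = fscale (z b) (\<sigma> b))"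
      by (rule monomial)
  qed (simp_all add: subspace act_closed act_add act_scale act_one act_mult basis)
qed

text \<open>Conjugation by \<open>h\<close>: the permutation becomes \<open>h\<close> after
  \<open>\<sigma>\<close> after the inverse of \<open>h\<close> on \<open>B\<close>, and the scalars
  are carried along unchanged.\<close>

lemma (in monomial_action) transport:
  assumes "linear_right_action H W' act'"
    and h: "Vector_Spaces.linear fscale fscale h" "bij_betw h W W'"
    and equiv: "\<And>v g. \<lbrakk>v \<in> W; g \<in> carrier H\<rbrakk> \<Longrightarrow> h (act v g) = act' (h v) g"
  shows "monomial_action H W' act' (h ` B)"
proof -
  interpret W': linear_right_action H W' act' by fact
  interpret h: Vector_Spaces.linear "fscale :: complex \<Rightarrow> ('c \<Rightarrow> complex) \<Rightarrow> _"
    "fscale :: complex \<Rightarrow> ('d \<Rightarrow> complex) \<Rightarrow> _" h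
    by fact
  have sp: "fn.span B = W" and ind: "fn.independent B"
    using basis by (auto simp: is_basis_def)
  have BW: "B \<subseteq> W"
    using sp fn.span_superset by blast
  have inj: "inj_on h W" and im: "h ` W = W'"
    using h(2) by (auto simp: bij_betw_def)
  have bijB: "bij_betw h B (h ` B)"
    using inj BW by (auto simp: bij_betw_def inj_on_subset)
  show ?thesis
  proof unfold_locales
    \<comment> \<open>\<open>h\<close> is linear on all functions but known to be injective only on
      \<open>W\<close>; since \<open>W\<close> is the span of \<open>B\<close>, this suffices to
      preserve independence.\<close>
    show "is_basis W' (h ` B)"
      using h.independent_injective_image[OF ind] inj h.span_image[of B] sp im
      by (simp add: is_basis_def)
  next
    fix g assume g: "g \<in> carrier H"
    then obtain \<sigma> z where \<sigma>: "bij_betw \<sigma> B B"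
      and z: "\<And>b. b \<in> B \<Longrightarrow> z b \<noteq> 0 \<and> act b g = fscale (z b) (\<sigma> b)"
      using monomial by metis
    let ?i = "the_inv_into B h"
    have i: "bij_betw ?i (h ` B) B"
      using bijB by (rule bij_betw_the_inv_into)
    have "bij_betw (h \<circ> \<sigma> \<circ> ?i) (h ` B) (h ` B)"
      by (intro bij_betw_trans[OF i] bij_betw_trans[OF \<sigma> bijB])
    moreover have "(z \<circ> ?i) c \<noteq> 0 \<and> act' c g = fscale ((z \<circ> ?i) c) ((h \<circ> \<sigma> \<circ> ?i) c)"
      if "c \<in> h ` B" for c
    proof -
      from that obtain b where b: "b \<in> B" "c = h b"
        by auto
      then have "?i c = b"
        using bijB by (simp add: bij_betw_def the_inv_into_f_f)
      moreover have "act' c g = h (act b g)"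
        using b BW g equiv[of b g] by auto
      ultimately show ?thesis
        using z[OF b(1)] by (simp add: h.scale)
    qed
    ultimately show "\<exists>\<sigma> z. bij_betw \<sigma> (h ` B) (h ` B) \<and>
        (\<forall>b\<in>h ` B. z b \<noteq> 0 \<and> act' b g = fscale (z b) (\<sigma> b))"
      by blast
  qed
qed

section \<open>Unitriangular and classical groups\<close>

text \<open>Left multiplication by \<open>a\<close> is injective, hence surjective on the finite set
  \<open>H\<close>, so it hits the identity. Both unitriangular groups are recognised as subgroups
  in this way, from closure under products.\<close>

lemma (in group) finite_submonoid_subgroup:
  assumes "H \<subseteq> carrier G" "finite H" "\<one> \<in> H" "\<And>x y. \<lbrakk>x \<in> H; y \<in> H\<rbrakk> \<Longrightarrow> x \<otimes> y \<in> H"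
  shows "subgroup H G"
proof (rule subgroupI)
  fix a assume a: "a \<in> H"
  have a': "a \<in> carrier G"
    using a assms(1) by blast
  have "inj_on (\<lambda>x. a \<otimes> x) H"
    using a' assms(1) by (auto intro!: inj_onI simp: subset_iff Units_eq)
  then have "(\<lambda>x. a \<otimes> x) ` H = H"
    using a assms by (intro endo_inj_surj) auto
  then have "\<one> \<in> (\<lambda>x. a \<otimes> x) ` H"
    using assms(3) by simp
  then obtain x where x: "x \<in> H" "a \<otimes> x = \<one>"
    by auto
  then have "inv x = a"
    using a' assms(1) by (intro inv_equality) auto
  then have "inv a = x"
    using x assms(1) by (metis inv_inv subsetD)
  then show "inv a \<in> H"
    using x by simp
qed (use assms in auto)

lemma finite_carrier_mat: "finite (carrier_mat nr nc :: 'a::finite mat set)"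
proof (rule finite_subset)
  show "carrier_mat nr nc \<subseteq> (\<lambda>g. mat nr nc g :: 'a mat) ` (({..<nr} \<times> {..<nc}) \<rightarrow>\<^sub>E UNIV)"
  proof
    fix A :: "'a mat" assume "A \<in> carrier_mat nr nc"
    then show "A \<in> (\<lambda>g. mat nr nc g) ` (({..<nr} \<times> {..<nc}) \<rightarrow>\<^sub>E UNIV)"
      by (intro image_eqI[of _ _ "restrict (\<lambda>ij. A $$ ij) ({..<nr} \<times> {..<nc})"]) auto
  qed
qed (simp add: finite_PiE)

lemma index_mult_mat_sum:
  assumes "A \<in> carrier_mat nr m" "B \<in> carrier_mat m nc" "i < nr" "j < nc"
  shows "(A * B) $$ (i, j) = (\<Sum>l<m. A $$ (i, l) * B $$ (l, j))"
  using assms by (simp add: scalar_prod_def atLeast0LessThan)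

lemma GL_simps:
  "carrier (GL N) = Units (ring_mat TYPE('a::field) N ())"
  "x \<otimes>\<^bsub>GL N\<^esub> y = x * (y :: 'a mat)"
  "\<one>\<^bsub>GL N\<^esub> = (1\<^sub>m N :: 'a mat)"
  by (simp_all add: GL_def units_of_def ring_mat_simps)

lemma group_GL: "group (GL N :: 'a::field mat monoid)"
proof -
  interpret R: ring "ring_mat TYPE('a) N ()"
    by (rule ring_mat)
  show ?thesis
    unfolding GL_def by (rule R.units_group)
qed

lemma Utilde_iff:
  "u \<in> Utilde t n \<longleftrightarrow> u \<in> carrier_mat (dimN t n) (dimN t n) \<and>
    (\<forall>i<dimN t n. \<forall>j<i. u $$ (i, j) = 0) \<and> (\<forall>i<dimN t n. u $$ (i, i) = 1)"
  by (auto simp: Utilde_def upper_triangular_def)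

lemma Utilde_carrier: "u \<in> Utilde t n \<Longrightarrow> u \<in> carrier_mat (dimN t n) (dimN t n)"
  by (simp add: Utilde_iff)

lemma one_in_Utilde: "1\<^sub>m (dimN t n) \<in> Utilde t n"
  by (simp add: Utilde_iff)

lemma Utilde_mult:
  assumes u: "u \<in> Utilde t n" and v: "v \<in> Utilde t n"
  shows "u * v \<in> Utilde t n"
proof -
  have c: "u \<in> carrier_mat (dimN t n) (dimN t n)" "v \<in> carrier_mat (dimN t n) (dimN t n)"
    using u v by (auto simp: Utilde_iff)
  have low: "(u * v) $$ (i, j) = 0" if "i < dimN t n" "j < i" for i j
  proof -
    have "u $$ (i, l) * v $$ (l, j) = 0" if "l < dimN t n" for l
      using that u v \<open>i < dimN t n\<close> \<open>j < i\<close> by (cases "l < i") (auto simp: Utilde_iff)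
    then show ?thesis
      using c that by (auto simp: index_mult_mat_sum simp del: index_mult_mat intro!: sum.neutral)
  qed
  have diag: "(u * v) $$ (i, i) = 1" if "i < dimN t n" for i
  proof -
    have "(u * v) $$ (i, i) = (\<Sum>l<dimN t n. if l = i then 1 else 0)"
      unfolding index_mult_mat_sum[OF c that that]
    proof (intro sum.cong refl)
      fix l assume "l \<in> {..<dimN t n}"
      then show "u $$ (i, l) * v $$ (l, i) = (if l = i then 1 else 0)"
        using u v that by (cases l i rule: linorder_cases) (auto simp: Utilde_iff)
    qed
    then show ?thesis
      using that by simp
  qed
  show ?thesis
    unfolding Utilde_iff using c low diag by (auto intro: mult_carrier_mat)
qed

text \<open>The determinant is the product of the diagonal entries, which is 1.\<close>

lemma Utilde_subset_GL: "Utilde t n \<subseteq> carrier (GL (dimN t n))"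
proof
  fix u :: "'a mat" assume u: "u \<in> Utilde t n"
  have "diag_mat u = replicate (dimN t n) 1"
    using u by (auto simp: diag_mat_def Utilde_iff list_eq_iff_nth_eq)
  then have "det u = 1"
    using u by (subst det_upper_triangular[of _ "dimN t n"]) (auto simp: Utilde_def)
  then show "u \<in> carrier (GL (dimN t n))"
    unfolding GL_simps using u by (intro det_non_zero_imp_unit Utilde_carrier) auto
qed

lemma finite_Utilde: "finite (Utilde t n :: 'a::{field,finite} mat set)"
  by (rule finite_subset[OF _ finite_carrier_mat]) (auto simp: Utilde_def)

lemma subgroup_Utilde: "subgroup (Utilde t n :: 'a::{field,finite} mat set) (GL (dimN t n))"
  by (rule group.finite_submonoid_subgroup[OF group_GL Utilde_subset_GL finite_Utilde])
    (simp_all add: GL_simps(2,3) one_in_Utilde Utilde_mult)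

lemma Utilde_group_simps:
  "carrier (Utilde_group t n) = Utilde t n"
  "x \<otimes>\<^bsub>Utilde_group t n\<^esub> y = x * y"
  "\<one>\<^bsub>Utilde_group t n\<^esub> = 1\<^sub>m (dimN t n)"
  by (simp_all add: Utilde_group_def GL_simps)

lemma U_group_simps:
  "carrier (U_group t n) = U t n"
  "x \<otimes>\<^bsub>U_group t n\<^esub> y = x * y"
  "\<one>\<^bsub>U_group t n\<^esub> = 1\<^sub>m (dimN t n)"
  by (simp_all add: U_group_def GL_simps)

section \<open>The group U as a subgroup of the unitriangular group\<close>

lemma formS_carrier[simp]: "formS t n \<in> carrier_mat (dimN t n) (dimN t n)"
  by (simp add: formS_def)

lemma dim_formS[simp]: "dim_row (formS t n) = dimN t n" "dim_col (formS t n) = dimN t n"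
  by (simp_all add: formS_def)

lemma U_iff: "u \<in> U t n \<longleftrightarrow> u \<in> Utilde t n \<and> transpose_mat u * formS t n * u = formS t n"
  using Utilde_subset_GL by (auto simp: U_def classical_group_def)

lemma U_subset_Utilde: "U t n \<subseteq> Utilde t n"
  by (auto simp: U_def)

lemma U_imp_Utilde: "u \<in> U t n \<Longrightarrow> u \<in> Utilde t n"
  by (rule subsetD[OF U_subset_Utilde])

lemma U_mult:
  assumes g: "g \<in> U t n" and h: "h \<in> U t n"
  shows "g * h \<in> U t n"
proof -
  let ?N = "dimN t n"
  have c: "g \<in> carrier_mat ?N ?N" "h \<in> carrier_mat ?N ?N"
    "transpose_mat g \<in> carrier_mat ?N ?N" "transpose_mat h \<in> carrier_mat ?N ?N"
    using g h by (auto simp: U_iff Utilde_iff)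
  note assoc = assoc_mult_mat[of _ ?N ?N _ ?N _ ?N] mult_carrier_mat[of _ ?N ?N _ ?N]
  have "transpose_mat (g * h) * formS t n * (g * h) =
      transpose_mat h * (transpose_mat g * formS t n * g) * h"
    using c by (simp add: transpose_mult[OF c(1,2)] assoc)
  with g h show ?thesis
    by (simp add: U_iff Utilde_mult)
qed

lemma subgroup_U_Utilde: "subgroup (U t n :: 'a::{field,finite} mat set) (Utilde_group t n)"
proof -
  have "group (Utilde_group t n :: 'a mat monoid)"
    unfolding Utilde_group_def by (rule group.subgroup_imp_group[OF group_GL subgroup_Utilde])
  moreover have "1\<^sub>m (dimN t n) \<in> (U t n :: 'a mat set)"
    by (simp add: U_iff one_in_Utilde left_mult_one_mat[of _ "dimN t n" "dimN t n"]
      right_mult_one_mat[of _ "dimN t n" "dimN t n"])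
  ultimately show ?thesis
    by (intro group.finite_submonoid_subgroup)
      (auto simp: Utilde_group_simps U_mult U_subset_Utilde intro: finite_subset[OF U_subset_Utilde finite_Utilde])
qed

lemma group_Utilde: "group (Utilde_group t n :: 'a::{field,finite} mat monoid)"
  unfolding Utilde_group_def by (rule group.subgroup_imp_group[OF group_GL subgroup_Utilde])

lemma U_group_eq: "U_group t n = (Utilde_group t n)\<lparr>carrier := U t n\<rparr>"
  by (simp add: U_group_def Utilde_group_def)

lemma group_U: "group (U_group t n :: 'a::{field,finite} mat monoid)"
  unfolding U_group_eq by (rule group.subgroup_imp_group[OF group_Utilde subgroup_U_Utilde])

lemma finite_U: "finite (U t n :: 'a::{field,finite} mat set)"
  by (rule finite_subset[OF _ finite_Utilde]) (auto simp: U_def)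

text \<open>\<open>minv\<close> inverts in the general linear group of the size of its argument.
  Inverses in a subgroup agree with those of the ambient group, so the group laws of the
  unitriangular group become available for \<open>minv\<close>.\<close>

lemma minv_eq_inv:
  fixes u :: "'a::{field,finite} mat"
  assumes "u \<in> Utilde t n"
  shows "minv u = inv\<^bsub>Utilde_group t n\<^esub> u"
  using group.m_inv_consistent[OF group_GL subgroup_Utilde assms] Utilde_carrier[OF assms]
  by (simp add: minv_def Utilde_group_def)

lemma minv_eq_inv_U:
  fixes u :: "'a::{field,finite} mat"
  assumes "u \<in> U t n"
  shows "minv u = inv\<^bsub>U_group t n\<^esub> u"
  using group.m_inv_consistent[OF group_Utilde subgroup_U_Utilde assms] assms minv_eq_inv[of u t n]
  by (simp add: U_group_eq U_iff)

lemma minv_U: "u \<in> U t n \<Longrightarrow> minv u \<in> (U t n :: 'a::{field,finite} mat set)"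
  using group.inv_closed[OF group_U, of u t n] by (simp add: minv_eq_inv_U[of _ t n] U_group_simps)

lemma
  fixes u :: "'a::{field,finite} mat"
  assumes u: "u \<in> Utilde t n"
  shows minv_Utilde: "minv u \<in> Utilde t n"
    and mult_minv: "u * minv u = 1\<^sub>m (dimN t n)"
    and minv_mult: "minv u * u = 1\<^sub>m (dimN t n)"
    and minv_minv: "minv (minv u) = u"
proof -
  interpret G: group "Utilde_group t n :: 'a mat monoid"
    by (rule group_Utilde)
  show *: "minv u \<in> Utilde t n"
    using G.inv_closed[of u] u by (simp add: minv_eq_inv[of _ t n] Utilde_group_simps)
  show "u * minv u = 1\<^sub>m (dimN t n)" "minv u * u = 1\<^sub>m (dimN t n)" "minv (minv u) = u"
    using G.r_inv[of u] G.l_inv[of u] G.inv_inv[of u] u *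
    by (simp_all add: minv_eq_inv[of _ t n] Utilde_group_simps)
qed

lemma minv_mult_distrib:
  fixes u v :: "'a::{field,finite} mat"
  assumes "u \<in> Utilde t n" "v \<in> Utilde t n"
  shows "minv (u * v) = minv v * minv u"
  using group.inv_mult_group[OF group_Utilde, of u t n v] assms
  by (simp add: minv_eq_inv[of _ t n] Utilde_group_simps Utilde_mult)

lemma minv_one: "minv (1\<^sub>m (dimN t n)) = (1\<^sub>m (dimN t n) :: 'a::{field,finite} mat)"
  using monoid.inv_one[OF group.is_monoid[OF group_Utilde[of t n, where 'a='a]]]
  by (simp add: minv_eq_inv[of _ t n] one_in_Utilde Utilde_group_simps)

section \<open>The affine action\<close>

lemma index_proj:
  "\<lbrakk>i < dimN t n; j < dimN t n\<rbrakk> \<Longrightarrow>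
    proj t n A $$ (i, j) = (if (i, j) \<in> posP t n then A $$ (i, j) else 0)"
  by (simp add: proj_def)

lemma proj_carrier[simp]: "proj t n A \<in> carrier_mat (dimN t n) (dimN t n)"
  by (simp add: proj_def)

lemma proj_in_V: "proj t n A \<in> V t n"
  by (simp add: V_def index_proj)

lemma V_carrier: "A \<in> V t n \<Longrightarrow> A \<in> carrier_mat (dimN t n) (dimN t n)"
  by (simp add: V_def)

lemma V_outside: "\<lbrakk>A \<in> V t n; (i, j) \<notin> posP t n; i < dimN t n; j < dimN t n\<rbrakk> \<Longrightarrow> A $$ (i, j) = 0"
  by (simp add: V_def)

lemma finite_V: "finite (V t n :: 'a::{field,finite} mat set)"
  by (rule finite_subset[OF _ finite_carrier_mat]) (auto simp: V_def)

lemma eq_on_posP: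
  assumes "A \<in> V t n" "B \<in> V t n"
    "\<And>i j. \<lbrakk>(i, j) \<in> posP t n; i < dimN t n; j < dimN t n\<rbrakk> \<Longrightarrow> A $$ (i, j) = B $$ (i, j)"
  shows "A = B"
proof (rule eq_matI)
  fix i j assume "i < dim_row B" "j < dim_col B"
  then have "i < dimN t n" "j < dimN t n"
    using V_carrier[OF assms(2)] by auto
  then show "A $$ (i, j) = B $$ (i, j)"
    using assms V_outside[OF assms(1)] V_outside[OF assms(2)] by (cases "(i, j) \<in> posP t n") auto
qed (use V_carrier[OF assms(1)] V_carrier[OF assms(2)] in auto)

lemma proj_V: "A \<in> V t n \<Longrightarrow> proj t n A = A"
  by (intro eq_on_posP[OF proj_in_V]) (auto simp: index_proj)

lemma posP_less: "(i, j) \<in> posP t n \<Longrightarrow> i < j"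
  by (simp add: posP_def)

lemma posP_left: "\<lbrakk>(i, j) \<in> posP t n; i < l; l \<le> j\<rbrakk> \<Longrightarrow> (i, l) \<in> posP t n"
  by (auto simp: posP_def split: if_splits)

lemma f_eq: "u \<in> Utilde t n \<Longrightarrow> f t n u = proj t n u"
  by (simp add: f_def)

lemma V_lower: "\<lbrakk>A \<in> V t n; i < dimN t n; j \<le> i\<rbrakk> \<Longrightarrow> A $$ (i, j) = 0"
  by (rule V_outside) (auto dest: posP_less)

lemma V_act_V: "V_act t n A u \<in> V t n"
  by (simp add: V_act_def proj_in_V)

lemma f_in_V: "u \<in> Utilde t n \<Longrightarrow> f t n u \<in> V t n"
  by (simp add: f_eq proj_in_V)

lemma one_add_V: "A \<in> V t n \<Longrightarrow> 1\<^sub>m (dimN t n) + A \<in> Utilde t n"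
  using V_carrier[of A t n] by (auto simp: Utilde_iff V_lower)

lemma proj_one_add_V: "A \<in> V t n \<Longrightarrow> proj t n (1\<^sub>m (dimN t n) + A) = A"
  using V_carrier[of A t n] posP_less[of _ _ t n]
  by (intro eq_on_posP[of _ t n]) (auto simp: proj_in_V index_proj)

text \<open>
  Right multiplication by an upper triangular matrix only moves entries to the right, and \<open>posP\<close>
  is closed under moving left towards the diagonal; so \<open>proj x\<close> determines \<open>proj (x * u)\<close>.
\<close>

lemma proj_mult_cong:
  assumes x: "x \<in> carrier_mat (dimN t n) (dimN t n)" and y: "y \<in> carrier_mat (dimN t n) (dimN t n)"
    and u: "u \<in> Utilde t n"
    and low: "\<And>i l. \<lbrakk>i < dimN t n; l \<le> i\<rbrakk> \<Longrightarrow> x $$ (i, l) = y $$ (i, l)"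
    and xy: "proj t n x = proj t n y"
  shows "proj t n (x * u) = proj t n (y * u)"
proof (rule eq_on_posP[OF proj_in_V proj_in_V])
  fix i j assume ij: "(i, j) \<in> posP t n" "i < dimN t n" "j < dimN t n"
  have "x $$ (i, l) * u $$ (l, j) = y $$ (i, l) * u $$ (l, j)" if l: "l < dimN t n" for l
  proof -
    \<comment> \<open>On and below the diagonal \<open>low\<close> applies; beyond column
      \<open>j\<close> the entry of \<open>u\<close> vanishes; in between, \<open>(i, l)\<close>
      lies in \<open>posP\<close> and the projections agree there.\<close>
    consider "l \<le> i" | "j < l" | "i < l" "l \<le> j"
      by linarith
    then show ?thesis
    proof cases
      case 3
      then have "(i, l) \<in> posP t n"
        using ij(1) posP_left by blast
      then show ?thesis
        using arg_cong[OF xy, of "\<lambda>M. M $$ (i, l)"] ij(2) l by (simp add: index_proj)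
    qed (use u low ij l in \<open>auto simp: Utilde_iff\<close>)
  qed
  then have "(\<Sum>l<dimN t n. x $$ (i, l) * u $$ (l, j)) = (\<Sum>l<dimN t n. y $$ (i, l) * u $$ (l, j))"
    by (intro sum.cong refl) simp
  then show "proj t n (x * u) $$ (i, j) = proj t n (y * u) $$ (i, j)"
    using ij x y Utilde_carrier[OF u]
    by (simp add: index_proj index_mult_mat_sum[of _ "dimN t n" "dimN t n" _ "dimN t n"]
        del: index_mult_mat)
qed

text \<open>Adding the identity replaces \<open>A\<close> by a unitriangular matrix with projection
  \<open>A\<close>.\<close>

definition affine_act :: "lie_type \<Rightarrow> nat \<Rightarrow> 'a::field mat \<Rightarrow> 'a mat \<Rightarrow> 'a mat" where
  "affine_act t n A u = proj t n ((1\<^sub>m (dimN t n) + A) * u)"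

lemma affine_act_V: "affine_act t n A u \<in> V t n"
  by (simp add: affine_act_def proj_in_V)

text \<open>\<open>x\<close> and \<open>1 + proj x\<close> are unitriangular with the same
  projection, so \<open>proj_mult_cong\<close> exchanges them. Thus \<open>f\<close> intertwines
  right multiplication with the affine action.\<close>

lemma affine_act_proj:
  assumes "x \<in> Utilde t n" "u \<in> Utilde t n"
  shows "affine_act t n (proj t n x) u = proj t n (x * u)"
  unfolding affine_act_def
  using assms one_add_V[OF proj_in_V[of t n x]]
  by (intro proj_mult_cong) (auto simp: Utilde_iff le_less proj_in_V proj_one_add_V)

lemma affine_act_one: "A \<in> V t n \<Longrightarrow> affine_act t n A (1\<^sub>m (dimN t n)) = A"
  using right_mult_one_mat[OF Utilde_carrier[OF one_add_V[of A t n]]]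
  by (simp add: affine_act_def proj_one_add_V)

text \<open>The inner value is the projection of the unitriangular matrix \<open>(1 + A) u\<close>,
  so \<open>affine_act_proj\<close> reduces the law to associativity of matrix
  multiplication.\<close>

lemma affine_act_mult:
  assumes "A \<in> V t n" "u \<in> Utilde t n" "v \<in> Utilde t n"
  shows "affine_act t n (affine_act t n A u) v = affine_act t n A (u * v)"
proof -
  note A = one_add_V[OF assms(1)]
  have "affine_act t n (affine_act t n A u) v = proj t n ((1\<^sub>m (dimN t n) + A) * u * v)"
    unfolding affine_act_def[of t n A u]
    by (intro affine_act_proj Utilde_mult A assms(2,3))
  also have "(1\<^sub>m (dimN t n) + A) * u * v = (1\<^sub>m (dimN t n) + A) * (u * v)"
    using Utilde_carrier[OF A] Utilde_carrier[OF assms(2)] Utilde_carrier[OF assms(3)]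
    by (rule assoc_mult_mat)
  finally show ?thesis
    by (simp add: affine_act_def)
qed

text \<open>Separates the linear part from the translation part; under a character the translation
  by \<open>f u\<close> becomes the monomial scalar.\<close>

lemma affine_act_eq:
  assumes "A \<in> V t n" "u \<in> Utilde t n"
  shows "affine_act t n A u = V_act t n A u + f t n u"
proof -
  have "(1\<^sub>m (dimN t n) + A) * u = u + A * u"
    using V_carrier[OF assms(1)] Utilde_carrier[OF assms(2)]
    by (simp add: add_mult_distrib_mat[of _ "dimN t n" "dimN t n"])
  then show ?thesis
    using V_carrier[OF assms(1)] Utilde_carrier[OF assms(2)]
    by (intro eq_matI) (auto simp: affine_act_def V_act_def f_eq assms(2) proj_def)
qed


text \<open>On and below the diagonal both \<open>A u\<close> and its projection vanish, so
  \<open>proj_mult_cong\<close> allows the inner projection to be dropped. This makes the action on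
  characters invertible.\<close>

lemma V_act_minv:
  fixes A :: "'a::{field,finite} mat"
  assumes A: "A \<in> V t n" and u: "u \<in> Utilde t n"
  shows "V_act t n (V_act t n A u) (minv u) = A"
proof -
  let ?N = "dimN t n"
  note c = V_carrier[OF A] Utilde_carrier[OF u] Utilde_carrier[OF minv_Utilde[OF u]]
  have low: "(A * u) $$ (i, j) = 0" if "i < ?N" "j \<le> i" for i j
  proof -
    have "A $$ (i, l) * u $$ (l, j) = 0" if "l < ?N" for l
      using that \<open>i < ?N\<close> \<open>j \<le> i\<close> u A by (cases "l \<le> i") (auto simp: Utilde_iff V_lower)
    then show ?thesis
      using that by (subst index_mult_mat_sum[OF c(1,2)]) (auto intro!: sum.neutral)
  qed
  have "V_act t n (V_act t n A u) (minv u) = proj t n (A * u * minv u)"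
    unfolding V_act_def using c u low
    by (intro proj_mult_cong)
      (auto simp: minv_Utilde V_lower[OF proj_in_V] proj_in_V proj_V simp del: index_mult_mat)
  also have "A * u * minv u = A"
    using c by (simp add: assoc_mult_mat[OF c] mult_minv[OF u])
  also have "proj t n A = A"
    using A by (rule proj_V)
  finally show ?thesis .
qed

section \<open>Characters of \<open>V\<close>\<close>

lemma kappa_eq_sum:
  assumes "A \<in> carrier_mat N N" "B \<in> carrier_mat N N"
  shows "kappa A B = (\<Sum>i<N. \<Sum>j<N. A $$ (i, j) * B $$ (i, j))"
proof -
  have "kappa A B = (\<Sum>j<N. (transpose_mat A * B) $$ (j, j))"
    using assms by (simp add: kappa_def diag_mat_def interv_sum_list_conv_sum_set_nat
      atLeast0LessThan del: index_mult_mat(1))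
  also have "\<dots> = (\<Sum>j<N. \<Sum>i<N. A $$ (i, j) * B $$ (i, j))"
    using assms by (intro sum.cong refl) (simp add: index_mult_mat_sum[of _ N N _ N] del: index_mult_mat(1))
  finally show ?thesis
    by (subst sum.swap)
qed

lemma kappa_commute:
  "\<lbrakk>A \<in> carrier_mat N N; B \<in> carrier_mat N N\<rbrakk> \<Longrightarrow> kappa A B = kappa B A"
  by (simp add: kappa_eq_sum mult.commute)

lemma kappa_add_right:
  "\<lbrakk>A \<in> carrier_mat N N; B \<in> carrier_mat N N; C \<in> carrier_mat N N\<rbrakk> \<Longrightarrow>
    kappa A (B + C) = kappa A B + kappa A C"
  by (simp add: kappa_eq_sum[of _ N] algebra_simps sum.distrib)

lemma kappa_diff_left:
  "\<lbrakk>A \<in> carrier_mat N N; B \<in> carrier_mat N N; C \<in> carrier_mat N N\<rbrakk> \<Longrightarrow>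
    kappa (A - B) C = kappa A C - kappa B C"
  by (simp add: kappa_eq_sum[of _ N] minus_carrier_mat algebra_simps sum_subtractf)

text \<open>The positions erased by \<open>proj\<close> are those where \<open>A\<close> is
  zero.\<close>

lemma kappa_proj_right:
  assumes "A \<in> V t n" "M \<in> carrier_mat (dimN t n) (dimN t n)"
  shows "kappa A (proj t n M) = kappa A M"
proof -
  have "A $$ (i, j) * proj t n M $$ (i, j) = A $$ (i, j) * M $$ (i, j)"
    if "i < dimN t n" "j < dimN t n" for i j
    using that V_outside[OF assms(1)] by (auto simp: index_proj)
  then show ?thesis
    using assms V_carrier[OF assms(1)]
    by (auto simp: kappa_eq_sum[of _ "dimN t n"] intro!: sum.cong)
qed

text \<open>Source of the inverse transpose in the formula for the permuted character: the adjoint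
  of a right multiplication for the trace form.\<close>

lemma kappa_mult_right:
  assumes "A \<in> carrier_mat N N" "B \<in> carrier_mat N N" "C \<in> carrier_mat N N"
  shows "kappa A (B * C) = kappa (A * transpose_mat C) B"
proof -
  have "kappa A (B * C) = (\<Sum>i<N. \<Sum>j<N. \<Sum>l<N. A $$ (i, j) * C $$ (l, j) * B $$ (i, l))"
    using assms
    by (simp add: kappa_eq_sum[of _ N] index_mult_mat_sum[of _ N N _ N] sum_distrib_left mult_ac
        mult_carrier_mat[of _ N N _ N] del: index_mult_mat(1))
  also have "\<dots> = (\<Sum>i<N. \<Sum>l<N. \<Sum>j<N. A $$ (i, j) * C $$ (l, j) * B $$ (i, l))"
    by (intro sum.cong refl sum.swap)
  also have "\<dots> = kappa (A * transpose_mat C) B"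
    using assms
    by (simp add: kappa_eq_sum[of _ N] index_mult_mat_sum[of _ N N _ N] sum_distrib_right
        mult_carrier_mat[of _ N N _ N] del: index_mult_mat(1))
  finally show ?thesis .
qed

lemma mat_add_minus_cancel:
  assumes "A \<in> carrier_mat nr nc" "B \<in> carrier_mat nr nc"
  shows "A + B - B = (A :: 'a::group_add mat)" "A - B + B = A"
  using assms by (auto intro!: eq_matI)

lemma mat_diff_eq_0_iff:
  "\<lbrakk>A \<in> carrier_mat nr nc; C \<in> carrier_mat nr nc\<rbrakk> \<Longrightarrow> A - C = 0\<^sub>m nr nc \<longleftrightarrow> A = (C :: 'a::ab_group_add mat)"
  by (auto simp: mat_eq_iff)

lemma V_add: "\<lbrakk>A \<in> V t n; B \<in> V t n\<rbrakk> \<Longrightarrow> A + B \<in> V t n"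
  by (auto simp: V_def)

lemma V_diff: "\<lbrakk>A \<in> V t n; B \<in> V t n\<rbrakk> \<Longrightarrow> A - B \<in> V t n"
  by (auto simp: V_def minus_carrier_mat)

section \<open>Orthogonality of characters and Fourier inversion on V\<close>

locale char_space =
  fixes t :: lie_type and n :: nat and \<theta> :: "'a::{field,finite} \<Rightarrow> complex"
  assumes nontrivial: "nontrivial_linear_character \<theta>"
begin

abbreviation N where "N \<equiv> dimN t n"

lemma theta_add: "\<theta> (x + y) = \<theta> x * \<theta> y"
  and theta_nz: "\<theta> x \<noteq> 0"
  using nontrivial by (auto simp: nontrivial_linear_character_def)

lemma theta_zero: "\<theta> 0 = 1"
  using theta_add[of 0 0] theta_nz[of 0] by simp

text \<open>For nonzero \<open>E\<close>, translating the summation variable by a suitable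
  \<open>B\<^sub>0\<close> multiplies the sum by a value of \<open>\<theta>\<close> other than 1, so
  the sum is 0.\<close>

lemma sum_theta_kappa:
  assumes E: "E \<in> V t n"
  shows "(\<Sum>B\<in>V t n. \<theta> (kappa E B)) = (if E = 0\<^sub>m N N then of_nat (card (V t n :: 'a mat set)) else 0)"
proof (cases "E = 0\<^sub>m N N")
  case True
  then have "kappa E B = 0" if "B \<in> V t n" for B
    using V_carrier[OF that] by (simp add: kappa_eq_sum[of _ N])
  then show ?thesis
    using True by (simp add: theta_zero)
next
  case False
  then obtain i j where ij: "i < N" "j < N" "E $$ (i, j) \<noteq> 0"
    using V_carrier[OF E] by (metis carrier_matD eq_matI index_zero_mat)
  obtain x where x: "\<theta> x \<noteq> 1"
    using nontrivial by (auto simp: nontrivial_linear_character_def)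
  \<comment> \<open>A single entry, at a position where \<open>E\<close> is nonzero, scaled so that
    \<open>kappa E B\<^sub>0 = x\<close>. Such a position lies in \<open>posP\<close> because
    \<open>E\<close> is in \<open>V\<close>, hence \<open>B\<^sub>0\<close> is in \<open>V\<close>
    too.\<close>
  define B\<^sub>0 where "B\<^sub>0 = mat N N (\<lambda>ab. if ab = (i, j) then x / E $$ (i, j) else 0)"
  have B0: "B\<^sub>0 \<in> V t n"
    using ij V_outside[OF E] by (auto simp: V_def B\<^sub>0_def)
  have "kappa E B\<^sub>0 = (\<Sum>a<N. \<Sum>b<N. if b = j then if a = i then x else 0 else 0)"
    unfolding kappa_eq_sum[OF V_carrier[OF E] V_carrier[OF B0]]
    using ij by (intro sum.cong refl) (auto simp: B\<^sub>0_def)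
  then have kB0: "kappa E B\<^sub>0 = x"
    using ij by simp
  have "(\<Sum>B\<in>V t n. \<theta> (kappa E B)) = (\<Sum>B\<in>V t n. \<theta> (kappa E (B + B\<^sub>0)))"
    by (rule sum.reindex_bij_witness[of _ "\<lambda>B. B + B\<^sub>0" "\<lambda>B. B - B\<^sub>0"])
      (use B0 in \<open>simp_all add: V_add V_diff mat_add_minus_cancel[of _ N N] V_carrier[of _ t n]\<close>)
  also have "\<dots> = \<theta> x * (\<Sum>B\<in>V t n. \<theta> (kappa E B))"
    using V_carrier[OF E] V_carrier[OF B0]
    by (simp add: V_carrier[of _ t n] kappa_add_right[of _ N] theta_add kB0 sum_distrib_left mult.commute)
  finally show ?thesis
    using x False by simp
qed

lemma theta_diff: "\<theta> (x - y) = \<theta> x * \<theta> (- y)"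
  using theta_add[of x "- y"] by simp

lemma card_V_nz: "of_nat (card (V t n :: 'a mat set)) \<noteq> (0::complex)"
  using finite_V[of t n, where 'a='a] proj_in_V[of t n] by auto

text \<open>The value of \<open>\<theta>\<close> at \<open>- kappa C B\<close> inverts that at
  \<open>kappa C B\<close>, so the summand is the character of \<open>A - C\<close>.\<close>

lemma chi_orthogonal:
  assumes A: "A \<in> V t n" and C: "C \<in> V t n"
  shows "(\<Sum>B\<in>V t n. chi t n \<theta> A B * \<theta> (- kappa C B)) =
    (if A = C then of_nat (card (V t n :: 'a mat set)) else 0)"
proof -
  have "(\<Sum>B\<in>V t n. chi t n \<theta> A B * \<theta> (- kappa C B)) = (\<Sum>B\<in>V t n. \<theta> (kappa (A - C) B))"
    using V_carrier[OF A] V_carrier[OF C]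
    by (intro sum.cong refl) (simp add: V_carrier[of _ t n] chi_def kappa_diff_left[of _ N] theta_diff)
  also have "\<dots> = (if A = C then of_nat (card (V t n :: 'a mat set)) else 0)"
    using V_carrier[OF A] V_carrier[OF C]
    by (simp add: sum_theta_kappa V_diff A C mat_diff_eq_0_iff)
  finally show ?thesis .
qed

lemma inj_on_chi: "inj_on (chi t n \<theta>) (V t n)"
proof (rule inj_onI)
  fix A C assume "A \<in> V t n" "C \<in> V t n" "chi t n \<theta> A = chi t n \<theta> C"
  then show "A = C"
    using chi_orthogonal[of A C] chi_orthogonal[of C C] card_V_nz by (auto split: if_splits)
qed

lemma finite_Vhat: "finite (Vhat t n \<theta>)"
  by (simp add: Vhat_def finite_V)

text \<open>Pairing a vanishing combination with the inverse of the character of \<open>C\<close>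
  leaves only the coefficient at \<open>C\<close>, times the nonzero number
  \<open>card V\<close>.\<close>

lemma independent_Vhat: "fn.independent (Vhat t n \<theta>)"
proof (rule fn.independent_if_scalars_zero[OF finite_Vhat])
  fix c \<chi> assume 0: "(\<Sum>\<chi>\<in>Vhat t n \<theta>. fscale (c \<chi>) \<chi>) = 0" and "\<chi> \<in> Vhat t n \<theta>"
  then obtain C where C: "C \<in> V t n" "\<chi> = chi t n \<theta> C"
    by (auto simp: Vhat_def)
  have "0 = (\<Sum>B\<in>V t n. (\<Sum>\<chi>\<in>Vhat t n \<theta>. fscale (c \<chi>) \<chi>) B * \<theta> (- kappa C B))"
    by (simp add: 0)
  also have "\<dots> = (\<Sum>B\<in>V t n. \<Sum>A\<in>V t n. c (chi t n \<theta> A) * (chi t n \<theta> A B * \<theta> (- kappa C B)))"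
    by (simp add: Vhat_def sum.reindex[OF inj_on_chi] fun_sum_apply fscale_def sum_distrib_right mult.assoc)
  also have "\<dots> = (\<Sum>A\<in>V t n. \<Sum>B\<in>V t n. c (chi t n \<theta> A) * (chi t n \<theta> A B * \<theta> (- kappa C B)))"
    by (rule sum.swap)
  also have "\<dots> = (\<Sum>A\<in>V t n. if A = C then c (chi t n \<theta> A) * of_nat (card (V t n :: 'a mat set)) else 0)"
    using C by (intro sum.cong refl) (simp add: sum_distrib_left[symmetric] chi_orthogonal)
  also have "\<dots> = c \<chi> * of_nat (card (V t n :: 'a mat set))"
    using C by (simp add: finite_V)
  finally show "c \<chi> = 0"
    using card_V_nz by simp
qed

lemma chi_in_fun_space: "chi t n \<theta> A \<in> fun_space (V t n)"
  by (simp add: chi_def fun_space_def)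

text \<open>Fourier inversion: since \<open>kappa\<close> is symmetric, the characters indexed by
  \<open>A\<close> evaluated at \<open>B\<close> are the values at \<open>A\<close> of the character
  of \<open>B\<close>, and orthogonality applies to \<open>B\<close> and \<open>D\<close>.\<close>

lemma delta_expansion:
  assumes D: "D \<in> V t n"
  shows "delta D = (\<Sum>A\<in>V t n. fscale (\<theta> (- kappa D A) / of_nat (card (V t n :: 'a mat set))) (chi t n \<theta> A))"
    (is "_ = ?R")
proof
  fix B
  show "delta D B = ?R B"
  proof (cases "B \<in> V t n")
    case True
    have "?R B = (\<Sum>A\<in>V t n. chi t n \<theta> B A * \<theta> (- kappa D A)) / of_nat (card (V t n :: 'a mat set))"
      unfolding sum_divide_distrib
      using True
      by (simp add: V_carrier[of _ t n] fun_sum_apply fscale_def chi_def kappa_commute[of B N] mult.commute cong: sum.cong)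
    then show ?thesis
      using True D card_V_nz by (simp add: chi_orthogonal delta_def)
  next
    case False
    then show ?thesis
      using D by (auto simp: fun_sum_apply fscale_def chi_def delta_def)
  qed
qed

lemma span_Vhat: "fn.span (Vhat t n \<theta>) = fun_space (V t n)"
proof
  show "fn.span (Vhat t n \<theta>) \<subseteq> fun_space (V t n)"
    by (intro fn.span_minimal subspace_fun_space) (auto simp: Vhat_def chi_in_fun_space)
  have delta: "delta D \<in> fn.span (Vhat t n \<theta>)" if "D \<in> V t n" for D
    unfolding delta_expansion[OF that]
    by (intro fn.span_sum fn.span_scale fn.span_base) (simp add: Vhat_def)
  show "fun_space (V t n) \<subseteq> fn.span (Vhat t n \<theta>)"
  proof
    fix \<tau> :: "'a mat \<Rightarrow> complex" assume \<tau>: "\<tau> \<in> fun_space (V t n)"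
    show "\<tau> \<in> fn.span (Vhat t n \<theta>)"
      by (subst fun_space_delta_sum[OF \<tau> finite_V])
        (intro fn.span_sum fn.span_scale delta)
  qed
qed

lemma is_basis_Vhat: "is_basis (fun_space (V t n)) (Vhat t n \<theta>)"
  by (simp add: is_basis_def independent_Vhat span_Vhat)

section \<open>The monomial action on functions on V\<close>

lemma chi_affine_act:
  assumes "A \<in> V t n" "B \<in> V t n" "u \<in> Utilde t n"
  shows "chi t n \<theta> A (affine_act t n B u) = chi t n \<theta> A (f t n u) * chi t n \<theta> A (V_act t n B u)"
  \<comment> \<open>The affine action is a sum of translation and linear part, which a character
    turns into a product.\<close>
  using assms
  by (simp add: affine_act_eq chi_def V_add V_act_V f_in_V kappa_add_right[of _ N] theta_add
      V_carrier[of _ t n])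

text \<open>Extended linearly, the monomial action is the dual of the affine action on \<^term>\<open>V t n\<close>.\<close>

lemma mon_act_eq:
  assumes \<tau>: "\<tau> \<in> fun_space (V t n)" and u: "u \<in> Utilde t n"
  shows "mon_act t n \<theta> \<tau> u = (\<lambda>B. if B \<in> V t n then \<tau> (affine_act t n B (minv u)) else 0)"
proof
  fix B
  let ?r = "fn.representation (Vhat t n \<theta>) \<tau>"
  \<comment> \<open>The expansion in characters is evaluated pointwise for every \<open>C\<close>,
    because it is needed at the moved point \<open>affine_act t n B (minv u)\<close>.\<close>
  have expand: "\<tau> C = (\<Sum>\<chi>\<in>Vhat t n \<theta>. ?r \<chi> * \<chi> C)" for C
  proof -
    have "(\<Sum>\<chi>\<in>Vhat t n \<theta>. fscale (?r \<chi>) \<chi>) = \<tau>"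
      using \<tau> by (intro fn.sum_representation_eq independent_Vhat finite_Vhat) (simp_all add: span_Vhat)
    then have "(\<Sum>\<chi>\<in>Vhat t n \<theta>. fscale (?r \<chi>) \<chi>) C = \<tau> C"
      by simp
    then show ?thesis
      by (simp add: fun_sum_apply fscale_def)
  qed
  have lhs: "mon_act t n \<theta> \<tau> u B = (\<Sum>\<chi>\<in>Vhat t n \<theta>. ?r \<chi> * (\<chi> (f t n (minv u)) * Vhat_act t n \<chi> u B))"
    by (simp add: mon_act_def fun_sum_apply fscale_def)
  show "mon_act t n \<theta> \<tau> u B = (if B \<in> V t n then \<tau> (affine_act t n B (minv u)) else 0)"
  proof (cases "B \<in> V t n")
    case True
    have "\<chi> (f t n (minv u)) * Vhat_act t n \<chi> u B = \<chi> (affine_act t n B (minv u))"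
      if "\<chi> \<in> Vhat t n \<theta>" for \<chi>
      using that True u by (auto simp: Vhat_def Vhat_act_def chi_affine_act minv_Utilde)
    then show ?thesis
      unfolding lhs by (simp add: True expand[of "affine_act t n B (minv u)"])
  qed (simp add: lhs Vhat_act_def)
qed

lemma mon_act_chi:
  assumes A: "A \<in> V t n" and u: "u \<in> Utilde t n"
  shows "mon_act t n \<theta> (chi t n \<theta> A) u =
    fscale (chi t n \<theta> A (f t n (minv u))) (Vhat_act t n (chi t n \<theta> A) u)"
  by (auto simp: mon_act_eq chi_in_fun_space u A Vhat_act_def fscale_def chi_affine_act minv_Utilde)

text \<open>The projection is dropped since \<open>A\<close> is in \<open>V\<close>, the factor
  \<open>minv u\<close> is moved across as its transpose, and a projection is reinserted since
  \<open>B\<close> is in \<open>V\<close>; symmetry of \<open>kappa\<close> brings each projection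
  to the right argument.\<close>

lemma Vhat_act_chi:
  assumes A: "A \<in> V t n" and u: "u \<in> Utilde t n"
  shows "Vhat_act t n (chi t n \<theta> A) u = chi t n \<theta> (proj t n (A * transpose_mat (minv u)))"
proof
  fix B
  note w = Utilde_carrier[OF minv_Utilde[OF u]]
  have "kappa A (proj t n (B * minv u)) = kappa (proj t n (A * transpose_mat (minv u))) B"
    if B: "B \<in> V t n"
  proof -
    have "kappa A (proj t n (B * minv u)) = kappa A (B * minv u)"
      using V_carrier[OF B] w by (intro kappa_proj_right[OF A]) auto
    also have "\<dots> = kappa (A * transpose_mat (minv u)) B"
      using V_carrier[OF A] V_carrier[OF B] w by (rule kappa_mult_right)
    also have "\<dots> = kappa B (A * transpose_mat (minv u))"
      using V_carrier[OF A] V_carrier[OF B] w by (intro kappa_commute) auto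
    also have "\<dots> = kappa B (proj t n (A * transpose_mat (minv u)))"
      using V_carrier[OF A] w by (intro kappa_proj_right[OF B, symmetric]) auto
    also have "\<dots> = kappa (proj t n (A * transpose_mat (minv u))) B"
      using V_carrier[OF B] by (intro kappa_commute) auto
    finally show ?thesis .
  qed
  then show "Vhat_act t n (chi t n \<theta> A) u B = chi t n \<theta> (proj t n (A * transpose_mat (minv u))) B"
    using V_act_V[of t n B "minv u"] by (auto simp: Vhat_act_def chi_def V_act_def)
qed

text \<open>\<open>Vhat_act\<close> already inverts its group element, so acting by \<open>u\<close>
  and then by \<open>minv u\<close> evaluates at \<open>B\<close> moved by \<open>u\<close> and then
  back by \<open>minv u\<close>.\<close>

lemma Vhat_act_minv:
  fixes \<chi> :: "'a mat \<Rightarrow> complex"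
  assumes "\<chi> \<in> fun_space (V t n)" "u \<in> Utilde t n"
  shows "Vhat_act t n (Vhat_act t n \<chi> u) (minv u) = \<chi>"
proof
  fix B
  show "Vhat_act t n (Vhat_act t n \<chi> u) (minv u) B = \<chi> B"
  proof (cases "B \<in> V t n")
    case True
    have "V_act t n (V_act t n B u) (minv u) = B"
      using True assms(2) by (rule V_act_minv)
    then show ?thesis
      using True by (simp add: Vhat_act_def V_act_V minv_minv[OF assms(2)])
  qed (use assms in \<open>auto simp: Vhat_act_def fun_space_def\<close>)
qed

lemma monomial_action_Utilde:
  "monomial_action (Utilde_group t n :: 'a mat monoid) (fun_space (V t n)) (mon_act t n \<theta>) (Vhat t n \<theta>)"
proof -
  interpret G: group "Utilde_group t n :: 'a mat monoid"
    by (rule group_Utilde)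
  show ?thesis
  proof (unfold_locales, unfold Utilde_group_simps)
    show "fn.subspace (fun_space (V t n))"
      by (rule subspace_fun_space)
    show "is_basis (fun_space (V t n)) (Vhat t n \<theta>)"
      by (rule is_basis_Vhat)
    show "mon_act t n \<theta> v g \<in> fun_space (V t n)" if "v \<in> fun_space (V t n)" "g \<in> Utilde t n" for v g
      using that by (simp add: mon_act_eq) (simp add: fun_space_def)
    show "mon_act t n \<theta> (v + w) g = mon_act t n \<theta> v g + mon_act t n \<theta> w g"
      if "v \<in> fun_space (V t n)" "w \<in> fun_space (V t n)" "g \<in> Utilde t n" for v w g
      using that by (auto simp: mon_act_eq fn.subspace_add[OF subspace_fun_space])
    show "mon_act t n \<theta> (fscale c v) g = fscale c (mon_act t n \<theta> v g)"
      if "v \<in> fun_space (V t n)" "g \<in> Utilde t n" for c v g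
      using that by (auto simp: mon_act_eq fn.subspace_scale[OF subspace_fun_space])
        (auto simp: fscale_def)
    show "mon_act t n \<theta> v (1\<^sub>m N) = v" if "v \<in> fun_space (V t n)" for v
      using that by (auto simp: mon_act_eq one_in_Utilde minv_one affine_act_one fun_space_def)
    \<comment> \<open>Inversion reverses the product: the argument is moved by \<open>minv h\<close>
      first and by \<open>minv g\<close> second, which makes precomposition a right action.\<close>
    show "mon_act t n \<theta> v (g * h) = mon_act t n \<theta> (mon_act t n \<theta> v g) h"
      if v: "v \<in> fun_space (V t n)" and gh: "g \<in> Utilde t n" "h \<in> Utilde t n" for v g h
    proof -
      have "mon_act t n \<theta> v g \<in> fun_space (V t n)"
        using v gh by (simp add: mon_act_eq) (simp add: fun_space_def)
      then show ?thesis
        using v gh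
        by (auto simp: mon_act_eq Utilde_mult minv_mult_distrib[of _ t n] minv_Utilde affine_act_V affine_act_mult)
    qed
    fix g :: "'a mat" assume g: "g \<in> Utilde t n"
    have inj: "inj_on (\<lambda>\<chi>. Vhat_act t n \<chi> g) (Vhat t n \<theta>)"
      by (rule inj_on_inverseI[of _ "\<lambda>\<chi>. Vhat_act t n \<chi> (minv g)"])
        (auto simp: Vhat_def Vhat_act_minv[OF chi_in_fun_space g])
    \<comment> \<open>An injective map of the finite set \<open>Vhat\<close> into itself is a
      permutation.\<close>
    have "(\<lambda>\<chi>. Vhat_act t n \<chi> g) ` Vhat t n \<theta> \<subseteq> Vhat t n \<theta>"
      using g by (auto simp: Vhat_def Vhat_act_chi proj_in_V)
    then have "bij_betw (\<lambda>\<chi>. Vhat_act t n \<chi> g) (Vhat t n \<theta>) (Vhat t n \<theta>)"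
      using inj endo_inj_surj[OF finite_Vhat] by (simp add: bij_betw_def)
    moreover have "\<forall>\<chi>\<in>Vhat t n \<theta>. \<chi> (f t n (minv g)) \<noteq> 0 \<and>
        mon_act t n \<theta> \<chi> g = fscale (\<chi> (f t n (minv g))) (Vhat_act t n \<chi> g)"
      using g by (auto simp: Vhat_def mon_act_chi) (simp add: chi_def f_in_V minv_Utilde theta_nz)
    ultimately show "\<exists>\<sigma> z. bij_betw \<sigma> (Vhat t n \<theta>) (Vhat t n \<theta>) \<and>
        (\<forall>b\<in>Vhat t n \<theta>. z b \<noteq> 0 \<and> mon_act t n \<theta> b g = fscale (z b) (\<sigma> b))"
      by (intro exI[of _ "\<lambda>\<chi>. Vhat_act t n \<chi> g"] exI[of _ "\<lambda>\<chi>. \<chi> (f t n (minv g))"] conjI)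
  qed
qed

end

section \<open>Bijectivity of \<open>f\<close> on \<open>U\<close>\<close>

text \<open>The shift by 1 permutes the field, so comparing the two sums of all elements shows that
  the cardinality is 0 in the field. Were 2 also 0, an odd cardinality would force 1 = 0.\<close>

lemma two_neq_zero:
  assumes "odd (CARD('a::{field,finite}))"
  shows "(2 :: 'a) \<noteq> 0"
proof
  assume 2: "(2 :: 'a) = 0"
  have "(\<Sum>x\<in>UNIV. x + 1) = (\<Sum>x\<in>UNIV. x :: 'a)"
    by (rule sum.reindex_bij_witness[of _ "\<lambda>x. x - 1" "\<lambda>x. x + 1"]) auto
  then have "of_nat (CARD('a)) = (0 :: 'a)"
    by (simp add: sum.distrib)
  moreover obtain m where "CARD('a) = 2 * m + 1"
    using assms by (elim oddE)
  ultimately show False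
    using 2 by simp
qed

section \<open>Injectivity of f on U\<close>

definition bar :: "lie_type \<Rightarrow> nat \<Rightarrow> nat \<Rightarrow> nat" where
  "bar t n i = dimN t n - 1 - i"

definition sgnS :: "lie_type \<Rightarrow> nat \<Rightarrow> nat \<Rightarrow> 'a::comm_ring_1" where
  "sgnS t n i = (if i < n then 1 else eps t)"

lemma bar_less: "i < dimN t n \<Longrightarrow> bar t n i < dimN t n"
  and bar_bar: "i < dimN t n \<Longrightarrow> bar t n (bar t n i) = i"
  and bar_eq_iff: "\<lbrakk>i < dimN t n; j < dimN t n\<rbrakk> \<Longrightarrow> bar t n i = j \<longleftrightarrow> bar t n j = i"
  and bar_less_iff: "\<lbrakk>i < dimN t n; j < dimN t n\<rbrakk> \<Longrightarrow> bar t n i < j \<longleftrightarrow> bar t n j < i"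
  by (auto simp: bar_def)

lemma posP_iff:
  "(i, j) \<in> posP t n \<longleftrightarrow> i < j \<and> (if t = TypeC then j \<le> bar t n i else j < bar t n i)"
  by (simp add: posP_def bar_def)

lemma sgnS_square: "sgnS t n i * sgnS t n i = (1 :: 'a::comm_ring_1)"
  by (simp add: sgnS_def eps_def)

text \<open>In types C and D exactly one of \<open>i\<close> and \<open>bar i\<close> is below
  \<open>n\<close>; in type B, whose middle index is its own mirror image, all signs are 1.\<close>

lemma sgnS_bar: "i < dimN t n \<Longrightarrow> sgnS t n i * sgnS t n (bar t n i) = (eps t :: 'a::comm_ring_1)"
  by (cases t) (auto simp: sgnS_def eps_def bar_def)

lemma index_formS:
  "\<lbrakk>i < dimN t n; j < dimN t n\<rbrakk> \<Longrightarrow>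
    formS t n $$ (i, j) = (if j = bar t n i then sgnS t n i else 0)"
  by (simp add: formS_def bar_def sgnS_def)

lemma index_formS_mult:
  assumes "M \<in> carrier_mat (dimN t n) (dimN t n)" "i < dimN t n" "j < dimN t n"
  shows "(formS t n * M) $$ (i, j) = sgnS t n i * M $$ (bar t n i, j)"
proof -
  have "(formS t n * M) $$ (i, j) =
      (\<Sum>l<dimN t n. if l = bar t n i then sgnS t n i * M $$ (l, j) else 0)"
    unfolding index_mult_mat_sum[OF formS_carrier assms]
    using assms by (intro sum.cong refl) (simp add: index_formS)
  then show ?thesis
    using assms by (simp add: bar_less)
qed

lemma index_mult_formS:
  assumes "M \<in> carrier_mat (dimN t n) (dimN t n)" "i < dimN t n" "j < dimN t n"
  shows "(M * formS t n) $$ (i, j) = M $$ (i, bar t n j) * sgnS t n (bar t n j)"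
proof -
  have "(M * formS t n) $$ (i, j) =
      (\<Sum>l<dimN t n. if l = bar t n j then M $$ (i, l) * sgnS t n l else 0)"
    unfolding index_mult_mat_sum[OF assms(1) formS_carrier assms(2,3)]
    using assms by (intro sum.cong refl) (auto simp: index_formS bar_bar)
  then show ?thesis
    using assms by (simp add: bar_less)
qed

text \<open>The entries outside \<open>posP\<close> are recovered from the last row upwards: in the
  form equation at \<open>(i, j)\<close> the known rows leave only the entries of \<open>g\<close>
  at \<open>(bar i, j)\<close> and at the mirrored position \<open>(bar j, i)\<close>.\<close>

lemma U_proj_trivial:
  fixes g :: "'a::field mat"
  assumes two: "(2 :: 'a) \<noteq> 0" and g: "g \<in> U t n"
    and proj0: "\<And>i j. \<lbrakk>(i, j) \<in> posP t n; i < dimN t n; j < dimN t n\<rbrakk> \<Longrightarrow> g $$ (i, j) = 0"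
  shows "g = 1\<^sub>m (dimN t n)"
proof -
  let ?N = "dimN t n"
  let ?b = "bar t n"
  let ?s = "sgnS t n :: nat \<Rightarrow> 'a"
  have gU: "g \<in> Utilde t n"
    using g U_subset_Utilde by blast
  note c = Utilde_carrier[OF gU]
  have rel: "(\<Sum>l<?N. g $$ (l, i) * (?s l * g $$ (?b l, j))) = (if j = ?b i then ?s i else 0)"
    if ij: "i < ?N" "j < ?N" for i j
  proof -
    have "(\<Sum>l<?N. g $$ (l, i) * (?s l * g $$ (?b l, j))) = (transpose_mat g * (formS t n * g)) $$ (i, j)"
      using c ij
      by (subst index_mult_mat_sum[of _ ?N ?N _ ?N])
        (auto simp: index_formS_mult mult_carrier_mat[of _ ?N ?N _ ?N] simp del: index_mult_mat(1)
          intro!: sum.cong)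
    also have "transpose_mat g * (formS t n * g) = formS t n"
      using g c by (simp add: U_iff assoc_mult_mat[of _ ?N ?N _ ?N _ ?N])
    finally show ?thesis
      using ij by (simp add: index_formS)
  qed
  have row: "g $$ (?b i, j) = (if j = ?b i then 1 else 0)" if "i < ?N" "j < ?N" for i j
    using that
  \<comment> \<open>Induction on \<open>i\<close> treats row \<open>bar i\<close>, so it starts with
    the last row.\<close>
  proof (induction i arbitrary: j rule: less_induct)
    case (less i)
    note ij = less.prems
    show ?case
    proof (cases "?b i < j \<and> (?b i, j) \<notin> posP t n")
      case False
      then consider "j < ?b i" | "j = ?b i" | "(?b i, j) \<in> posP t n"
        by linarith
      then show ?thesis
        using gU ij proj0[of "?b i" j] bar_less[of i t n]
        by cases (auto simp: Utilde_iff dest: posP_less)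
    next
      case True
      then have bij: "?b i < j" "?b j < i" "i \<le> j"
        using ij by (auto simp: posP_iff bar_bar bar_less_iff split: if_splits)
      \<comment> \<open>Terms with \<open>l > i\<close> vanish by triangularity. For
        \<open>l < i\<close>, row \<open>bar l\<close> is a row of the identity by induction, so
        only \<open>l = bar j\<close> contributes; this index is below \<open>i\<close> by
        \<open>bij\<close>.\<close>
      have "g $$ (l, i) * (?s l * g $$ (?b l, j)) =
          (if l = ?b j then ?s l * g $$ (l, i) else 0) + (if l = i then ?s i * g $$ (?b i, j) else 0)"
        if l: "l < ?N" for l
      proof -
        consider "l < i" | "l = i" | "i < l"
          by linarith
        then show ?thesis
        proof cases
          case 1
          then show ?thesis
            using less.IH[OF 1 l ij(2)] l ij by (auto simp: bar_eq_iff[of l t n j] bar_bar)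
        qed (use gU l bij in \<open>auto simp: Utilde_iff\<close>)
      qed
      then have "(\<Sum>l<?N. g $$ (l, i) * (?s l * g $$ (?b l, j))) =
          (\<Sum>l<?N. (if l = ?b j then ?s l * g $$ (l, i) else 0) + (if l = i then ?s i * g $$ (?b i, j) else 0))"
        by (intro sum.cong refl) simp
      also have "\<dots> = ?s (?b j) * g $$ (?b j, i) + ?s i * g $$ (?b i, j)"
        using ij by (simp add: sum.distrib bar_less)
      finally have sum0: "?s (?b j) * g $$ (?b j, i) + ?s i * g $$ (?b i, j) = 0"
        using rel[OF ij] bij by simp
      show ?thesis
      \<comment> \<open>Off the antidiagonal the mirrored position \<open>(bar j, i)\<close> lies in
        \<open>posP\<close>, where \<open>g\<close> is zero by assumption.\<close>
      proof (cases "i < j")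
        case True
        then have "(?b j, i) \<in> posP t n"
          using bij ij bar_bar[of j t n] by (auto simp: posP_iff)
        then have "g $$ (?b j, i) = 0"
          using ij by (intro proj0) (auto simp: bar_less)
        then have "?s i * g $$ (?b i, j) = 0"
          using sum0 by simp
        then have "?s i * ?s i * g $$ (?b i, j) = 0"
          by simp
        then show ?thesis
          using bij by (simp only: sgnS_square) simp
      next
        case False
        \<comment> \<open>On the antidiagonal the two remaining terms coincide. In type C such
          positions belong to \<open>posP\<close>, so only types B and D occur, where all signs are
          1 and division by 2 finishes.\<close>
        then have "i = j"
          using bij by simp
        moreover from this have "t \<noteq> TypeC"
          using \<open>?b i < j \<and> (?b i, j) \<notin> posP t n\<close> ij by (auto simp: posP_iff bar_bar)
        then have "?s l = 1" for l
          by (simp add: sgnS_def eps_def)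
        ultimately have "2 * g $$ (?b i, j) = 0"
          using sum0 by (simp only: mult_1 mult_2)
        then show ?thesis
          using two bij by simp
      qed
    qed
  qed
  have "g $$ (i, j) = (if j = i then 1 else 0)" if "i < ?N" "j < ?N" for i j
    using row[of "?b i" j] that by (simp add: bar_less bar_bar)
  then show ?thesis
    using c by (intro eq_matI) auto
qed

text \<open>\<open>f\<close> is no homomorphism, but acting by \<open>minv y\<close> turns equal
  projections of \<open>x\<close> and \<open>y\<close> into equal projections of
  \<open>x * minv y\<close> and the identity, so the kernel-like case \<open>U_proj_trivial\<close>
  suffices.\<close>

lemma inj_on_f_U:
  assumes two: "(2 :: 'a::{field,finite}) \<noteq> 0"
  shows "inj_on (f t n) (U t n :: 'a mat set)"
proof (rule inj_onI)
  fix x y :: "'a mat" assume x: "x \<in> U t n" and y: "y \<in> U t n" and xy: "f t n x = f t n y"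
  then have xU: "x \<in> Utilde t n" and yU: "y \<in> Utilde t n"
    using U_subset_Utilde by auto
  note c = Utilde_carrier[OF xU] Utilde_carrier[OF minv_Utilde[OF yU]] Utilde_carrier[OF yU]
  have "proj t n (x * minv y) = proj t n (y * minv y)"
    using xU yU xy affine_act_proj[OF _ minv_Utilde[OF yU], of x] affine_act_proj[OF _ minv_Utilde[OF yU], of y]
    by (simp add: f_eq)
  then have 1: "proj t n (x * minv y) = proj t n (1\<^sub>m (dimN t n))"
    by (simp add: mult_minv[OF yU])
  have "x * minv y = 1\<^sub>m (dimN t n)"
  proof (rule U_proj_trivial[OF two U_mult[OF x minv_U[OF y]]])
    fix i j assume "(i, j) \<in> posP t n" "i < dimN t n" "j < dimN t n"
    then show "(x * minv y) $$ (i, j) = 0"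
      using arg_cong[OF 1, of "\<lambda>M. M $$ (i, j)"] by (auto simp: index_proj dest: posP_less)
  qed
  then have "x * minv y * y = 1\<^sub>m (dimN t n) * y"
    by simp
  then show "x = y"
    using c by (simp add: assoc_mult_mat[OF c] minv_mult[OF yU])
qed

section \<open>The Cayley transform and surjectivity of f\<close>

text \<open>Entrywise form of \<open>A - S\<inverse> A\<^sup>t S\<close>, an element of the Lie algebra \<open>X\<^sup>t S + S X = 0\<close>.\<close>

definition skew_part :: "lie_type \<Rightarrow> nat \<Rightarrow> 'a::field mat \<Rightarrow> 'a mat" where
  "skew_part t n A = mat (dimN t n) (dimN t n)
     (\<lambda>(a, b). A $$ (a, b) - sgnS t n (bar t n a) * sgnS t n (bar t n b) * A $$ (bar t n b, bar t n a))"

lemma skew_part_carrier[simp]: "skew_part t n A \<in> carrier_mat (dimN t n) (dimN t n)"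
  by (simp add: skew_part_def)

lemma dim_skew_part[simp]:
  "dim_row (skew_part t n A) = dimN t n" "dim_col (skew_part t n A) = dimN t n"
  by (simp_all add: skew_part_def)

text \<open>This is the \<open>(i, j)\<close> entry of \<open>S X = - X^t S\<close>.\<close>

lemma skew_part_skew:
  assumes "i < dimN t n" "j < dimN t n"
  shows "sgnS t n i * skew_part t n A $$ (bar t n i, j) =
    - (sgnS t n (bar t n j) * skew_part t n A $$ (bar t n j, i))"
proof -
  let ?s = "sgnS t n :: nat \<Rightarrow> 'a" and ?b = "bar t n"
  \<comment> \<open>Both mirrored pairs of signs have product \<open>eps t\<close>, so one pair can
    replace the other.\<close>
  have "?s (?b j) * (?s j * ?s (?b i)) = ?s j * ?s (?b j) * ?s (?b i)"
    by (simp only: mult_ac)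
  also have "\<dots> = ?s i * ?s (?b i) * ?s (?b i)"
    by (simp only: sgnS_bar[OF assms(1)] sgnS_bar[OF assms(2)])
  also have "\<dots> = ?s i"
    by (simp only: mult.assoc sgnS_square mult_1_right)
  finally have s: "?s (?b j) * (?s j * ?s (?b i)) = ?s i" .
  have "?s i * skew_part t n A $$ (?b i, j) =
      ?s i * A $$ (?b i, j) - ?s i * ?s i * (?s (?b j) * A $$ (?b j, i))"
    using assms by (simp add: skew_part_def bar_less bar_bar right_diff_distrib mult.assoc)
  also have "\<dots> = ?s (?b j) * (?s j * ?s (?b i)) * A $$ (?b i, j) - ?s (?b j) * A $$ (?b j, i)"
    by (simp only: s sgnS_square mult_1_left)
  also have "\<dots> = - (?s (?b j) * skew_part t n A $$ (?b j, i))"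
    using assms by (simp add: skew_part_def bar_less bar_bar right_diff_distrib mult.assoc)
  finally show ?thesis .
qed

text \<open>Reflection in the antidiagonal, \<open>(i, j)\<close> to \<open>(bar j, bar i)\<close>,
  preserves the region on and below the diagonal, where \<open>A\<close> vanishes.\<close>

lemma skew_part_lower:
  assumes "A \<in> V t n" "i < dimN t n" "j \<le> i"
  shows "skew_part t n A $$ (i, j) = 0"
  using assms V_lower[OF assms(1), of i j] V_lower[OF assms(1), of "bar t n j" "bar t n i"]
    bar_less[of j t n]
  by (simp add: skew_part_def) (simp add: bar_def)

text \<open>The reflection moves positions of \<open>posP\<close> out of \<open>posP\<close> except
  for the antidiagonal ones, which it fixes. Those occur only in type C, where the sign -1 doubles
  the entry.\<close>

lemma skew_part_posP:
  assumes A: "A \<in> V t n" and ij: "(i, j) \<in> posP t n" "i < dimN t n" "j < dimN t n"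
  shows "skew_part t n A $$ (i, j) = (if j = bar t n i then 2 else 1) * A $$ (i, j)"
proof (cases "j = bar t n i")
  case True
  then have "sgnS t n j * sgnS t n i = (- 1 :: 'a)"
    using ij sgnS_bar[OF ij(2), where 'a='a] by (auto simp: posP_iff eps_def mult.commute split: if_splits)
  then show ?thesis
    using True ij by (simp add: skew_part_def bar_bar)
next
  case False
  then have "(bar t n j, bar t n i) \<notin> posP t n"
    using ij by (auto simp: posP_iff bar_bar split: if_splits)
  then show ?thesis
    using False ij V_outside[OF A] by (simp add: skew_part_def bar_less)
qed

definition cayley :: "lie_type \<Rightarrow> nat \<Rightarrow> 'a::field mat \<Rightarrow> 'a mat" where
  "cayley t n A =
     (1\<^sub>m (dimN t n) + skew_part t n A) * minv (1\<^sub>m (dimN t n) - skew_part t n A)"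

context
  fixes t n and A D E :: "'a::{field,finite} mat"
  assumes A: "A \<in> V t n"
  defines "D \<equiv> 1\<^sub>m (dimN t n) - skew_part t n A" and "E \<equiv> 1\<^sub>m (dimN t n) + skew_part t n A"
begin

lemma cayley_factors_Utilde: "D \<in> Utilde t n" "E \<in> Utilde t n"
  by (auto simp: Utilde_iff D_def E_def skew_part_lower A minus_carrier_mat)

text \<open>Skewness gives \<open>S E = D^t S\<close> and \<open>E^t S = S D\<close>. With
  \<open>w = D^-1\<close> the form at \<open>E w\<close> becomes
  \<open>w^t S D E w = w^t S E D w = w^t S E = w^t D^t S = S\<close>, once \<open>D\<close> and
  \<open>E\<close> are known to commute.\<close>

lemma cayley_in_U: "cayley t n A \<in> U t n"
proof -
  let ?N = "dimN t n"
  let ?S = "formS t n :: 'a mat"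
  let ?X = "skew_part t n A"
  define w where "w = minv D"
  note DU = cayley_factors_Utilde(1) and EU = cayley_factors_Utilde(2)
  have wU: "w \<in> Utilde t n"
    by (simp add: w_def minv_Utilde DU)
  note c = Utilde_carrier[OF DU] Utilde_carrier[OF EU] Utilde_carrier[OF wU] formS_carrier[of t n, where 'a='a]
  note assoc = assoc_mult_mat[of _ ?N ?N _ ?N _ ?N] mult_carrier_mat[of _ ?N ?N _ ?N]
  have SE: "?S * E = transpose_mat D * ?S"
  proof (rule eq_matI)
    fix i j assume "i < dim_row (transpose_mat D * ?S)" "j < dim_col (transpose_mat D * ?S)"
    then have ij: "i < ?N" "j < ?N"
      using c by auto
    show "(?S * E) $$ (i, j) = (transpose_mat D * ?S) $$ (i, j)"
      using c ij skew_part_skew[OF ij, of A] bar_eq_iff[OF ij]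
      by (auto simp: index_formS_mult index_mult_formS D_def E_def bar_less bar_bar algebra_simps
          simp del: index_mult_mat(1))
  qed (use c in auto)
  have ES: "transpose_mat E * ?S = ?S * D"
  proof (rule eq_matI)
    fix i j assume "i < dim_row (?S * D)" "j < dim_col (?S * D)"
    then have ij: "i < ?N" "j < ?N"
      using c by auto
    show "(transpose_mat E * ?S) $$ (i, j) = (?S * D) $$ (i, j)"
      using c ij skew_part_skew[OF ij, of A] bar_eq_iff[OF ij]
      by (auto simp: index_formS_mult index_mult_formS D_def E_def bar_less bar_bar algebra_simps
          simp del: index_mult_mat(1))
  qed (use c in auto)
  \<comment> \<open>\<open>D\<close> and \<open>E\<close> commute, both being polynomials in
    \<open>?X\<close>.\<close>
  have "D * E = 1\<^sub>m ?N * E - ?X * E"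
    unfolding D_def using c by (intro minus_mult_distrib_mat) auto
  also have "?X * E = ?X * 1\<^sub>m ?N + ?X * ?X"
    unfolding E_def by (intro mult_add_distrib_mat) auto
  also have "1\<^sub>m ?N * E - (?X * 1\<^sub>m ?N + ?X * ?X) = E * 1\<^sub>m ?N - (1\<^sub>m ?N * ?X + ?X * ?X)"
    using c by simp
  also have "1\<^sub>m ?N * ?X + ?X * ?X = E * ?X"
    unfolding E_def by (intro add_mult_distrib_mat[symmetric]) auto
  also have "E * 1\<^sub>m ?N - E * ?X = E * D"
    unfolding D_def using c by (intro mult_minus_distrib_mat[symmetric]) auto
  finally have DE: "D * E = E * D" .
  have Dw: "D * w = 1\<^sub>m ?N"
    unfolding w_def by (rule mult_minv[OF DU])
  have "transpose_mat (E * w) * ?S * (E * w) = transpose_mat w * ((transpose_mat E * ?S) * (E * w))"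
    using c by (simp add: transpose_mult[OF c(2,3)] assoc)
  also have "(transpose_mat E * ?S) * (E * w) = ?S * ((D * E) * w)"
    unfolding ES using c by (simp add: assoc)
  also have "(D * E) * w = E * (D * w)"
    unfolding DE using c by (simp add: assoc)
  also have "?S * (E * (D * w)) = transpose_mat D * ?S"
    using c SE by (simp add: Dw)
  also have "transpose_mat w * (transpose_mat D * ?S) = transpose_mat (D * w) * ?S"
    using c by (simp add: transpose_mult[OF c(1,3)] assoc)
  also have "\<dots> = ?S"
    by (simp add: Dw left_mult_one_mat[of _ ?N ?N])
  finally have "transpose_mat (E * w) * ?S * (E * w) = ?S" .
  moreover have "cayley t n A = E * w"
    by (simp add: cayley_def w_def D_def E_def)
  ultimately show ?thesis
    using Utilde_mult[OF EU wU] by (simp add: U_iff)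
qed

text \<open>Follows from \<open>E + D = 2\<close>. It recovers \<open>D\<close> from the Cayley
  transform after division by 2.\<close>

lemma cayley_add_one: "cayley t n A + 1\<^sub>m (dimN t n) = 2 \<cdot>\<^sub>m minv D"
proof -
  let ?N = "dimN t n"
  note DU = cayley_factors_Utilde(1) and EU = cayley_factors_Utilde(2)
  note c = Utilde_carrier[OF DU] Utilde_carrier[OF EU] Utilde_carrier[OF minv_Utilde[OF DU]]
  have "cayley t n A + 1\<^sub>m ?N = E * minv D + D * minv D"
    by (simp add: cayley_def mult_minv[OF DU] D_def[symmetric] E_def[symmetric])
  also have "\<dots> = (E + D) * minv D"
    using c by (simp add: add_mult_distrib_mat[of _ ?N ?N])
  also have "E + D = 2 \<cdot>\<^sub>m 1\<^sub>m ?N"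
    by (rule eq_matI) (auto simp: D_def E_def skew_part_def)
  finally show ?thesis
    using c by (simp add: mult_smult_assoc_mat[of _ ?N ?N _ ?N])
qed

end

text \<open>The transform determines \<open>D\<close>, hence the skew matrix, whose entries on
  \<open>posP\<close> are those of \<open>A\<close> up to the factors 1 and 2.\<close>

lemma inj_on_cayley:
  assumes two: "(2 :: 'a::{field,finite}) \<noteq> 0"
  shows "inj_on (cayley t n) (V t n :: 'a mat set)"
proof (rule inj_onI)
  fix A B :: "'a mat" assume A: "A \<in> V t n" and B: "B \<in> V t n" and eq: "cayley t n A = cayley t n B"
  let ?N = "dimN t n"
  let ?D = "\<lambda>A. 1\<^sub>m ?N - skew_part t n A"
  have U: "?D A \<in> Utilde t n" "?D B \<in> Utilde t n"
    using cayley_factors_Utilde(1) A B by auto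
  have "2 \<cdot>\<^sub>m minv (?D A) = 2 \<cdot>\<^sub>m minv (?D B)"
    using cayley_add_one[OF A] cayley_add_one[OF B] eq by simp
  then have "minv (?D A) = minv (?D B)"
    using two by (auto simp: mat_eq_iff)
  then have D: "?D A = ?D B"
    using minv_minv[OF U(1)] minv_minv[OF U(2)] by metis
  show "A = B"
  proof (rule eq_on_posP[OF A B])
    fix i j assume ij: "(i, j) \<in> posP t n" "i < ?N" "j < ?N"
    have "skew_part t n A $$ (i, j) = skew_part t n B $$ (i, j)"
      using arg_cong[OF D, of "\<lambda>M. M $$ (i, j)"] ij by simp
    then show "A $$ (i, j) = B $$ (i, j)"
      using two by (simp add: skew_part_posP[OF A ij] skew_part_posP[OF B ij] split: if_splits)
  qed
qed

lemma bij_betw_f: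
  assumes two: "(2 :: 'a::{field,finite}) \<noteq> 0"
  shows "bij_betw (f t n) (U t n :: 'a mat set) (V t n)"
proof -
  have "card (V t n :: 'a mat set) \<le> card (U t n :: 'a mat set)"
    using cayley_in_U by (intro card_inj_on_le[OF inj_on_cayley[OF two] _ finite_U]) auto
  moreover have sub: "f t n ` (U t n :: 'a mat set) \<subseteq> V t n"
    by (auto simp: f_eq[OF U_imp_Utilde] proj_in_V)
  \<comment> \<open>The image has as many elements as \<open>U\<close>, hence at least as many as
    the finite set \<open>V\<close> containing it.\<close>
  ultimately have "f t n ` (U t n :: 'a mat set) = V t n"
    using card_image[OF inj_on_f_U[OF two, of t n]] by (intro card_seteq finite_V) auto
  then show ?thesis
    using inj_on_f_U[OF two] by (simp add: bij_betw_def)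
qed

section \<open>The isomorphism with the regular module\<close>

context char_space
begin

lemma fstar_eq: "fstar t n \<tau> = (\<lambda>u. if u \<in> U t n then \<tau> (f t n u) else (0 :: complex))"
  for \<tau> :: "'a mat \<Rightarrow> complex"
proof
  fix u
  have "fstar t n \<tau> u = (\<Sum>x\<in>U t n. if x = u then \<tau> (f t n x) else 0)"
    by (auto simp: fstar_def fun_sum_apply fscale_def delta_def intro!: sum.cong)
  then show "fstar t n \<tau> u = (if u \<in> U t n then \<tau> (f t n u) else 0)"
    by (simp add: finite_U)
qed

text \<open>As \<open>A\<close> is in \<open>V\<close>, the trace form does not distinguish
  \<open>u\<close> from \<open>f u\<close>.\<close>

lemma fstar_chi: "A \<in> V t n \<Longrightarrow> fstar t n (chi t n \<theta> A) = U_elem t n \<theta> A"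
  by (auto simp: fstar_def U_elem_def chi_def f_eq[OF U_imp_Utilde] proj_in_V kappa_proj_right
      Utilde_carrier[OF U_imp_Utilde] intro!: sum.cong)

lemma linear_fstar: "Vector_Spaces.linear fscale fscale (fstar t n :: ('a mat \<Rightarrow> complex) \<Rightarrow> _)"
  by unfold_locales (auto simp: fstar_eq fscale_def)

lemma bij_betw_fstar:
  assumes "(2 :: 'a) \<noteq> 0"
  shows "bij_betw (fstar t n) (fun_space (V t n :: 'a mat set)) (fun_space (U t n))"
proof -
  note bij = bij_betw_f[OF assms, of t n]
  let ?i = "the_inv_into (U t n :: 'a mat set) (f t n)"
  have inv: "?i (f t n u) = u" "f t n u \<in> V t n" if "u \<in> U t n" for u
    using bij that by (auto simp: bij_betw_def the_inv_into_f_f)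
  have inv': "f t n (?i B) = B" "?i B \<in> U t n" if "B \<in> V t n" for B
    using bij that by (auto simp: bij_betw_def f_the_inv_into_f the_inv_into_into)
  show ?thesis
    \<comment> \<open>The inverse map pulls back along the inverse of \<open>f\<close> and is zero
      off \<open>V\<close>.\<close>
    by (rule bij_betw_byWitness[where f' = "\<lambda>\<sigma> B. if B \<in> V t n then \<sigma> (?i B) else 0"])
      (auto simp: fun_space_def fstar_eq inv inv' fun_eq_iff)
qed

text \<open>By \<open>affine_act_proj\<close>, moving \<open>f u\<close> by \<open>minv g\<close>
  gives \<open>f (u * minv g)\<close>.\<close>

lemma fstar_mon_act:
  assumes \<tau>: "\<tau> \<in> fun_space (V t n)" and g: "g \<in> U t n" and u: "u \<in> U t n"
  shows "mon_act t n \<theta> \<tau> g (f t n u) = fstar t n \<tau> (u * minv g)"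
proof -
  have U: "g \<in> Utilde t n" "u \<in> Utilde t n"
    using g u U_subset_Utilde by auto
  then show ?thesis
    using g u by (simp add: mon_act_eq[OF \<tau>] f_in_V fstar_eq U_mult minv_U f_eq proj_in_V
        affine_act_proj minv_Utilde Utilde_mult)
qed

lemma monomial_action_U:
  "monomial_action (U_group t n :: 'a mat monoid) (fun_space (V t n)) (mon_act t n \<theta>) (Vhat t n \<theta>)"
  unfolding U_group_eq
  by (rule monomial_action.restrict_subgroup[OF monomial_action_Utilde subgroup_U_Utilde])

text \<open>On \<open>U\<close> both sides are the convolution sum of \<open>a h\<close> times
  \<open>fstar t n \<tau>\<close> at \<open>u * minv h\<close>; off \<open>U\<close> both
  vanish.\<close>

lemma fstar_algebra_act:
  assumes \<tau>: "\<tau> \<in> fun_space (V t n)"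
  shows "fstar t n (algebra_act (U_group t n) (mon_act t n \<theta>) \<tau> a) =
    fstar t n \<tau> \<otimes>\<^bsub>group_algebra (U_group t n)\<^esub> (a :: 'a mat \<Rightarrow> complex)"
proof
  interpret G: group "U_group t n :: 'a mat monoid"
    by (rule group_U)
  fix u
  show "fstar t n (algebra_act (U_group t n) (mon_act t n \<theta>) \<tau> a) u =
    (fstar t n \<tau> \<otimes>\<^bsub>group_algebra (U_group t n)\<^esub> a) u"
  proof (cases "u \<in> U t n")
    case True
    have "fstar t n (algebra_act (U_group t n) (mon_act t n \<theta>) \<tau> a) u =
        algebra_act (U_group t n) (mon_act t n \<theta>) \<tau> a (f t n u)"
      using True by (simp add: fstar_eq)
    also have "\<dots> = (\<Sum>h\<in>U t n. a h * mon_act t n \<theta> \<tau> h (f t n u))"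
      by (simp add: algebra_act_def U_group_simps fun_sum_apply) (simp add: fscale_def)
    also have "\<dots> = (\<Sum>h\<in>U t n. a h * fstar t n \<tau> (u * minv h))"
      using True by (simp add: fstar_mon_act[OF \<tau>])
    also have "\<dots> = (fstar t n \<tau> \<otimes>\<^bsub>group_algebra (U_group t n)\<^esub> a) u"
      using True
      by (simp add: G.group_algebra_mult_convolution U_group_simps finite_U minv_eq_inv_U[of _ t n])
    finally show ?thesis .
  next
    case False
    then show ?thesis
      using G.group_algebra_mult_closed[of "fstar t n \<tau>" a]
      by (simp add: fstar_eq fun_space_def U_group_simps)
  qed
qed

lemma fstar_mon_act_delta:
  assumes \<tau>: "\<tau> \<in> fun_space (V t n)" and g: "g \<in> U t n"
  shows "fstar t n (mon_act t n \<theta> \<tau> g) =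
    fstar t n \<tau> \<otimes>\<^bsub>group_algebra (U_group t n)\<^esub> delta g"
proof -
  have "algebra_act (U_group t n) (mon_act t n \<theta>) \<tau> (delta g) =
      (\<Sum>h\<in>U t n. if h = g then mon_act t n \<theta> \<tau> h else 0)"
    unfolding algebra_act_def U_group_simps
    by (intro sum.cong refl) (auto simp: delta_def fscale_def fun_eq_iff)
  then have "algebra_act (U_group t n) (mon_act t n \<theta>) \<tau> (delta g) = mon_act t n \<theta> \<tau> g"
    using g by (simp add: finite_U)
  then show ?thesis
    using fstar_algebra_act[OF \<tau>, of "delta g"] by simp
qed

end

theorem theorem3p9:
  fixes t :: lie_type and n p k q :: nat
    and \<theta> :: "'a::{field,finite} \<Rightarrow> complex"
  assumes "prime p" and "odd p" and "k \<ge> 1" and "q = p ^ k" and "CARD('a) = q"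
    and "nontrivial_linear_character \<theta>"
  shows
    "monomial_action (Utilde_group t n :: 'a mat monoid)
       (fun_space (V t n)) (mon_act t n \<theta>) (Vhat t n \<theta>)
     \<and> (\<forall>u\<in>Utilde t n. \<forall>A\<in>V t n. \<exists>z.
          z = \<theta> (kappa A (proj t n (minv u)))
          \<and> z = chi t n \<theta> A (f t n (minv u))
          \<and> z \<noteq> 0
          \<and> mon_act t n \<theta> (chi t n \<theta> A) u = fscale z (Vhat_act t n (chi t n \<theta> A) u)
          \<and> Vhat_act t n (chi t n \<theta> A) u
              = chi t n \<theta> (proj t n (A * transpose_mat (minv u))))
     \<and> bij_betw (f t n) (U t n :: 'a mat set) (V t n)
     \<and> (\<forall>A\<in>V t n. fstar t n (chi t n \<theta> A) = U_elem t n \<theta> A)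
     \<and> right_module_iso (group_algebra (U_group t n :: 'a mat monoid))
         (fun_space (V t n)) (algebra_act (U_group t n) (mon_act t n \<theta>))
         (carrier (group_algebra (U_group t n)))
         (\<lambda>a b. a \<otimes>\<^bsub>group_algebra (U_group t n)\<^esub> b)
         (fstar t n)
     \<and> monomial_action (U_group t n :: 'a mat monoid)
         (carrier (group_algebra (U_group t n)))
         (\<lambda>a u. a \<otimes>\<^bsub>group_algebra (U_group t n)\<^esub> delta u)
         (U_elem t n \<theta> ` V t n)"
proof (intro conjI ballI)
  interpret char_space t n \<theta>
    by unfold_locales fact
  have "odd (CARD('a))"
    using assms by simp
  then have two: "(2 :: 'a) \<noteq> 0"
    by (rule two_neq_zero)
  have fin: "finite (carrier (U_group t n :: 'a mat monoid))"
    by (simp add: U_group_simps finite_U)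
  have carrier: "carrier (group_algebra (U_group t n :: 'a mat monoid)) = fun_space (U t n)"
    by (simp add: group_algebra_simps U_group_simps)
  interpret MU: monomial_action "U_group t n :: 'a mat monoid" "fun_space (V t n)" "mon_act t n \<theta>" "Vhat t n \<theta>"
    by (rule monomial_action_U)
  show "monomial_action (Utilde_group t n :: 'a mat monoid) (fun_space (V t n)) (mon_act t n \<theta>) (Vhat t n \<theta>)"
    by (rule monomial_action_Utilde)
  show "\<exists>z. z = \<theta> (kappa A (proj t n (minv u))) \<and> z = chi t n \<theta> A (f t n (minv u)) \<and> z \<noteq> 0
      \<and> mon_act t n \<theta> (chi t n \<theta> A) u = fscale z (Vhat_act t n (chi t n \<theta> A) u)
      \<and> Vhat_act t n (chi t n \<theta> A) u = chi t n \<theta> (proj t n (A * transpose_mat (minv u)))"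
    if "u \<in> Utilde t n" "A \<in> V t n" for u A :: "'a mat"
  proof -
    have "\<theta> (kappa A (proj t n (minv u))) = chi t n \<theta> A (f t n (minv u))"
      using that by (simp add: chi_def f_in_V minv_Utilde f_eq proj_in_V)
    then show ?thesis
      using theta_nz[of "kappa A (proj t n (minv u))"] mon_act_chi[OF that(2,1)] Vhat_act_chi[OF that(2,1)]
      by simp
  qed
  show "bij_betw (f t n) (U t n :: 'a mat set) (V t n)"
    by (rule bij_betw_f[OF two])
  show "fstar t n (chi t n \<theta> A) = U_elem t n \<theta> A" if "A \<in> V t n" for A
    by (rule fstar_chi[OF that])
  interpret fstar: Vector_Spaces.linear fscale fscale "fstar t n :: ('a mat \<Rightarrow> complex) \<Rightarrow> _"
    by (rule linear_fstar)
  show "right_module_iso (group_algebra (U_group t n :: 'a mat monoid))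
      (fun_space (V t n)) (algebra_act (U_group t n) (mon_act t n \<theta>))
      (carrier (group_algebra (U_group t n)))
      (\<lambda>a b. a \<otimes>\<^bsub>group_algebra (U_group t n)\<^esub> b) (fstar t n)"
    unfolding right_module_iso_def
    using MU.right_module_algebra_act[OF fin] group.right_module_group_algebra[OF group_U fin]
      bij_betw_fstar[OF two]
    by (simp add: carrier fstar_algebra_act fstar.add)
  \<comment> \<open>The proposed basis is the image of the characters, so the monomial structure is
    transported along \<open>fstar\<close>.\<close>
  have "U_elem t n \<theta> ` V t n = fstar t n ` Vhat t n \<theta>"
    by (auto simp: Vhat_def fstar_chi image_image cong: image_cong)
  moreover have "monomial_action (U_group t n) (carrier (group_algebra (U_group t n)))
      (\<lambda>a u. a \<otimes>\<^bsub>group_algebra (U_group t n)\<^esub> delta u) (fstar t n ` Vhat t n \<theta>)"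
    by (rule MU.transport[OF linear_right_action_group_algebra[OF group_U fin] linear_fstar])
      (simp_all add: carrier bij_betw_fstar[OF two] fstar_mon_act_delta U_group_simps)
  ultimately show "monomial_action (U_group t n :: 'a mat monoid) (carrier (group_algebra (U_group t n)))
      (\<lambda>a u. a \<otimes>\<^bsub>group_algebra (U_group t n)\<^esub> delta u) (U_elem t n \<theta> ` V t n)"
    by simp
qed

end
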